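(* Let $d>1$ be an integer. For each $n\in\{0,1,2,3,5,7,9,15,27\}$ there exists a smooth cubic surface over the finite field $\mathbb{F}_{2^d}$ containing exactly $n$ lines defined over $\mathbb{F}_{2^d}$.
   Context: A line on a smooth cubic surface $X$ over a field $k$ is defined over $k$ if it is a line $L\subset\mathbb{P}^3_k$ (cut out by linear forms with coefficients in $k$) with $L\subseteq X$ as schemes. *)

theory Defs
  imports "HOL-Algebra.Algebraic_Closure_Type" "HOL-Analysis.Finite_Cartesian_Product"
begin

text \<open>Homogeneous coordinates on P^3 are indexed by the 4-element type 4.
  A cubic form in x_0..x_3 over k is given by its coefficient function on
  exponent vectors e :: 4 => nat of total degree 3.\<close>

definition mons3 :: "(4 \<Rightarrow> nat) set" where
  "mons3 = {e. (\<Sum>i\<in>UNIV. e i) = 3}"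

definition eval_cubic :: "('a \<Rightarrow> 'b::comm_ring_1) \<Rightarrow> ((4 \<Rightarrow> nat) \<Rightarrow> 'a) \<Rightarrow> 'b^4 \<Rightarrow> 'b" where
  "eval_cubic h F x = (\<Sum>e\<in>mons3. h (F e) * (\<Prod>i\<in>UNIV. (x $ i) ^ e i))"

definition eval_partial :: "('a \<Rightarrow> 'b::comm_ring_1) \<Rightarrow> ((4 \<Rightarrow> nat) \<Rightarrow> 'a) \<Rightarrow> 4 \<Rightarrow> 'b^4 \<Rightarrow> 'b" where
  "eval_partial h F j x =
     (\<Sum>e\<in>mons3. of_nat (e j) * h (F e) *
        (\<Prod>i\<in>UNIV. (x $ i) ^ (if i = j then e i - 1 else e i)))"

definition smooth_cubic :: "((4 \<Rightarrow> nat) \<Rightarrow> 'a::field) \<Rightarrow> bool" where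
  "smooth_cubic F \<longleftrightarrow>
     (\<exists>e\<in>mons3. F e \<noteq> 0) \<and>
     \<not> (\<exists>x :: 'a alg_closure ^ 4. x \<noteq> 0 \<and> eval_cubic to_ac F x = 0 \<and>
            (\<forall>j. eval_partial to_ac F j x = 0))"

text \<open>The line of P^3_k spanned by two linearly independent k-rational
  vectors p, q, represented as the 2-dimensional subspace of k^4.\<close>
definition span2 :: "'a::field^4 \<Rightarrow> 'a^4 \<Rightarrow> ('a^4) set" where
  "span2 p q = {s *s p + t *s q | s t. True}"

definition lin_indep2 :: "'a::field^4 \<Rightarrow> 'a^4 \<Rightarrow> bool" where
  "lin_indep2 p q \<longleftrightarrow> (\<forall>s t. s *s p + t *s q = 0 \<longrightarrow> s = 0 \<and> t = 0)"

text \<open>Scheme-theoretic containment L \<subseteq> X: the restriction of F to the line,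
  F(s p + t q), vanishes identically; since the algebraic closure is infinite,
  this is the same as vanishing at all (s,t) over the algebraic closure.\<close>
definition line_in_cubic :: "((4 \<Rightarrow> nat) \<Rightarrow> 'a::field) \<Rightarrow> 'a^4 \<Rightarrow> 'a^4 \<Rightarrow> bool" where
  "line_in_cubic F p q \<longleftrightarrow>
     (\<forall>s t :: 'a alg_closure.
        eval_cubic to_ac F (s *s (\<chi> i. to_ac (p $ i)) + t *s (\<chi> i. to_ac (q $ i))) = 0)"

definition k_lines :: "((4 \<Rightarrow> nat) \<Rightarrow> 'a::field) \<Rightarrow> ('a^4) set set" where
  "k_lines F = {span2 p q | p q. lin_indep2 p q \<and> line_in_cubic F p q}"

end

theory Submission
  imports Defs "HOL-Analysis.Cartesian_Space" "HOL-Number_Theory.Residues"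
begin

text \<open>
  Over a field $k$ of characteristic two, a binary quintic form
  $h(u, v) = u\,q_1(u^2, v^2) + v\,q_2(u^2, v^2)$ defines the cubic surface
  $x^2 w + y^2 z + x\,q_1(z, w) + y\,q_2(z, w) = 0$, which contains the skew lines $x = y = 0$ and
  $z = w = 0$. It is the blow-up of five points $((u : v), (u^2 : v^2))$ of
  $\mathbb{P}^1 \times \mathbb{P}^1$, one for each root of $h$, and is smooth when $h$ is separable.
  Its $k$-lines are the two skew lines, three lines for each $k$-rational root of $h$, and one line
  for each cubic factor of $h$ over $k$: the line $(z, w) = M (x, y)$ corresponds to
  the cubic $g = w(t, 1)\, t^2 + z(t, 1)$. The factorization patterns $1^5$, $1^3 2$, $1^2 3$, $1\, 2^2$,
  $1\, 4$, $5$ give $27, 15, 9, 7, 5, 2$ lines; here $1^5$ needs $|k| \ge 4$. The counts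
  $0$, $1$ and $3$ come from special surfaces on which each $k$-line is forced into a known plane.
\<close>

no_notation fps_nth (infixl \<open>$\<close> 75)

subsection \<open>Sparse cubic forms\<close>

text \<open>The projection to \<open>((x : y), (z : w))\<close> from the two skew lines is the
  blow-down. Transversals are its exceptional curves; the two fibres through a blown-up point give
  the other two lines of a root. The graph of a matrix is a curve of bidegree (1,1), and it passes
  through the point of \<open>t\<close> exactly when \<open>t^2 = z/w\<close> there, that is, when
  \<open>g(t) = 0\<close>; hence the cubic factors. Squares in the second coordinate suit
  characteristic two: the partial derivatives in x and y are \<open>q1\<close> and
  \<open>q2\<close>, while \<open>h'(t) = q1(t^2, 1)\<close>, so singular points and multiple roots
  are governed by the same common zeros. Square roots needed on the way exist in k because squaring
  is bijective there. One root may lie at infinity, so that polynomials of degree four suffice for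
  every pattern except the irreducible quintic; with four field elements it is also the only way to
  have five rational roots. The two skew lines are always rational, so this family cannot give 0 or
  1.\<close>

lemma finite_mons3: "finite mons3"
proof -
  have "mons3 \<subseteq> (UNIV \<rightarrow> {..3})"
  proof safe
    fix e :: "4 \<Rightarrow> nat" and i assume "e \<in> mons3"
    then show "e i \<le> 3"
      using member_le_sum[of i UNIV e] by (auto simp: mons3_def)
  qed
  moreover have "finite ((UNIV :: 4 set) \<rightarrow> {..3::nat})"
    using finite_PiE[of "UNIV :: 4 set" "\<lambda>_. {..3::nat}"] by (simp add: PiE_UNIV_domain)
  ultimately show ?thesis by (rule finite_subset)
qed

text \<open>The coordinates x, y, z, w are the indices 1, 2, 3, 4. In the type \<open>4\<close> the
  numeral 4 equals 0, so the last branch covers exactly that index.\<close>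

definition mono4 :: "nat \<Rightarrow> nat \<Rightarrow> nat \<Rightarrow> nat \<Rightarrow> 4 \<Rightarrow> nat" where
  "mono4 a b c d = (\<lambda>i. if i = 1 then a else if i = 2 then b else if i = 3 then c else d)"

lemma mono4_simps [simp]:
  "mono4 a b c d 1 = a" "mono4 a b c d 2 = b" "mono4 a b c d 3 = c" "mono4 a b c d 4 = d"
  by (simp_all add: mono4_def)

lemma mono4_eq_iff [simp]:
  "mono4 a b c d = mono4 a' b' c' d' \<longleftrightarrow> a = a' \<and> b = b' \<and> c = c' \<and> d = d'"
  by (auto simp: fun_eq_iff forall_4)

lemma mono4_in_mons3 [simp]: "mono4 a b c d \<in> mons3 \<longleftrightarrow> a + b + c + d = 3"
  by (simp add: mons3_def sum_4)

lemma prod_4: "prod f (UNIV :: 4 set) = f 1 * f 2 * f 3 * f 4"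
  unfolding UNIV_4 by (simp add: ac_simps)

fun sparse_form :: "('a::comm_monoid_add \<times> (4 \<Rightarrow> nat)) list \<Rightarrow> (4 \<Rightarrow> nat) \<Rightarrow> 'a" where
  "sparse_form [] e = 0"
| "sparse_form ((c, m) # ts) e = (if e = m then c else 0) + sparse_form ts e"

lemma sum_if_eq_times:
  fixes h :: "'a::comm_monoid_add \<Rightarrow> 'b::comm_ring_1"
  assumes h: "h 0 = 0" and m: "m \<in> mons3"
  shows "(\<Sum>e\<in>mons3. h (if e = m then c else 0) * g e) = h c * g m"
proof -
  have "(\<Sum>e\<in>mons3. h (if e = m then c else 0) * g e) = (\<Sum>e\<in>mons3. if e = m then h c * g e else 0)"
    by (intro sum.cong) (auto simp: h)
  then show ?thesis using m finite_mons3 by simp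
qed

text \<open>Of \<open>h\<close> only additivity is required, so that the same expansion is available
  for \<open>id\<close> on rational points and for \<open>to_ac\<close> over the closure.\<close>

lemma eval_sparse_form:
  fixes h :: "'a::comm_monoid_add \<Rightarrow> 'b::comm_ring_1"
  assumes h: "h 0 = 0" "\<And>a b. h (a + b) = h a + h b"
    and "\<forall>(c, m) \<in> set ts. m \<in> mons3"
  shows "eval_cubic h (sparse_form ts) x = (\<Sum>(c, m)\<leftarrow>ts. h c * (\<Prod>i\<in>UNIV. (x $ i) ^ m i))"
  using assms(3)
proof (induction ts)
  case Nil
  then show ?case by (simp add: eval_cubic_def h)
next
  case (Cons t ts)
  obtain c m where t: "t = (c, m)" by force
  have "eval_cubic h (sparse_form (t # ts)) x =
     (\<Sum>e\<in>mons3. h (if e = m then c else 0) * (\<Prod>i\<in>UNIV. (x $ i) ^ e i)) + eval_cubic h (sparse_form ts) x"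
    by (simp add: eval_cubic_def t h distrib_right sum.distrib)
  also have "(\<Sum>e\<in>mons3. h (if e = m then c else 0) * (\<Prod>i\<in>UNIV. (x $ i) ^ e i)) = h c * (\<Prod>i\<in>UNIV. (x $ i) ^ m i)"
    using Cons.prems t by (intro sum_if_eq_times h) auto
  finally show ?case using Cons t by (simp del: sparse_form.simps)
qed

lemma eval_partial_sparse_form:
  fixes h :: "'a::comm_monoid_add \<Rightarrow> 'b::comm_ring_1"
  assumes h: "h 0 = 0" "\<And>a b. h (a + b) = h a + h b"
    and "\<forall>(c, m) \<in> set ts. m \<in> mons3"
  shows "eval_partial h (sparse_form ts) j x =
    (\<Sum>(c, m)\<leftarrow>ts. h c * (of_nat (m j) * (\<Prod>i\<in>UNIV. (x $ i) ^ (if i = j then m i - 1 else m i))))"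
  using assms(3)
proof (induction ts)
  case Nil
  then show ?case by (simp add: eval_partial_def h)
next
  case (Cons t ts)
  obtain c m where t: "t = (c, m)" by force
  have "eval_partial h (sparse_form (t # ts)) j x =
     (\<Sum>e\<in>mons3. h (if e = m then c else 0) *
        (of_nat (e j) * (\<Prod>i\<in>UNIV. (x $ i) ^ (if i = j then e i - 1 else e i)))) +
      eval_partial h (sparse_form ts) j x"
    by (simp add: eval_partial_def t h algebra_simps sum.distrib)
  also have "(\<Sum>e\<in>mons3. h (if e = m then c else 0) *
        (of_nat (e j) * (\<Prod>i\<in>UNIV. (x $ i) ^ (if i = j then e i - 1 else e i)))) =
      h c * (of_nat (m j) * (\<Prod>i\<in>UNIV. (x $ i) ^ (if i = j then m i - 1 else m i)))"
    using Cons.prems t by (intro sum_if_eq_times h) auto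
  finally show ?case using Cons t by (simp del: sparse_form.simps)
qed

definition vec4 :: "'a \<Rightarrow> 'a \<Rightarrow> 'a \<Rightarrow> 'a \<Rightarrow> 'a ^ 4" where
  "vec4 a b c d = (\<chi> i. if i = 1 then a else if i = 2 then b else if i = 3 then c else d)"

lemma vec4_nth [simp]:
  "vec4 a b c d $ 1 = a" "vec4 a b c d $ 2 = b" "vec4 a b c d $ 3 = c" "vec4 a b c d $ 4 = d"
  by (simp_all add: vec4_def)

lemma vec4_eq_iff: "(x :: 'a ^ 4) = y \<longleftrightarrow> x $ 1 = y $ 1 \<and> x $ 2 = y $ 2 \<and> x $ 3 = y $ 3 \<and> x $ 4 = y $ 4"
  by (auto simp: vec_eq_iff forall_4)

subsection \<open>Testing lines on rational points\<close>

lemma map_poly_to_ac_mult: "map_poly to_ac (p * q) = map_poly to_ac p * map_poly to_ac q"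
  by (intro poly_eqI) (simp add: coeff_map_poly coeff_mult to_ac_sum)

lemma map_poly_to_ac_smult: "map_poly to_ac (smult c p) = smult (to_ac c) (map_poly to_ac p)"
  by (intro poly_eqI) (simp add: coeff_map_poly)

lemma map_poly_to_ac_sum: "map_poly to_ac (sum f A) = (\<Sum>x\<in>A. map_poly to_ac (f x))"
  by (intro poly_eqI) (simp add: coeff_map_poly coeff_sum to_ac_sum)

lemma map_poly_to_ac_power: "map_poly to_ac (p ^ n) = map_poly to_ac p ^ n"
  by (induction n) (simp_all add: map_poly_to_ac_mult)

lemma map_poly_to_ac_prod: "map_poly to_ac (prod f A) = (\<Prod>x\<in>A. map_poly to_ac (f x))"
  by (induction A rule: infinite_finite_induct) (simp_all add: map_poly_to_ac_mult)

lemma eval_cubic_scale: "eval_cubic h F (c *s x) = c ^ 3 * eval_cubic h F x"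
proof -
  have "(\<Prod>i\<in>UNIV. ((c *s x) $ i) ^ e i) = c ^ 3 * (\<Prod>i\<in>UNIV. (x $ i) ^ e i)" if "e \<in> mons3" for e
  proof -
    have "(\<Prod>i\<in>UNIV. ((c *s x) $ i) ^ e i) = c ^ (\<Sum>i\<in>UNIV. e i) * (\<Prod>i\<in>UNIV. (x $ i) ^ e i)"
      by (simp add: power_mult_distrib prod.distrib power_sum)
    then show ?thesis using that by (simp add: mons3_def)
  qed
  then show ?thesis
    by (simp add: eval_cubic_def sum_distrib_left mult_ac)
qed

lemma eval_cubic_to_ac: "eval_cubic to_ac F (\<chi> i. to_ac (x $ i)) = to_ac (eval_cubic id F x)"
  by (simp add: eval_cubic_def to_ac_sum to_ac_prod)

text \<open>The restriction of a cubic form to an affine line is a polynomial of degree at most three, so with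
  at least four elements in the field its vanishing can be tested on rational points.\<close>
lemma line_in_cubic_iff:
  fixes F :: "(4 \<Rightarrow> nat) \<Rightarrow> 'a::{finite,field}"
  assumes card: "CARD('a) \<ge> 4"
  shows "line_in_cubic F p q \<longleftrightarrow> (\<forall>v\<in>span2 p q. eval_cubic id F v = 0)"
proof
  assume *: "line_in_cubic F p q"
  show "\<forall>v\<in>span2 p q. eval_cubic id F v = 0"
  proof
    fix v assume "v \<in> span2 p q"
    then obtain s t where v: "v = s *s p + t *s q" by (auto simp: span2_def)
    have "to_ac (eval_cubic id F v) = eval_cubic to_ac F (\<chi> i. to_ac (v $ i))"
      by (simp add: eval_cubic_to_ac)
    also have "(\<chi> i. to_ac (v $ i)) = to_ac s *s (\<chi> i. to_ac (p $ i)) + to_ac t *s (\<chi> i. to_ac (q $ i))"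
      by (simp add: v vec_eq_iff)
    also have "eval_cubic to_ac F \<dots> = 0" using * by (simp add: line_in_cubic_def)
    finally show "eval_cubic id F v = 0" by (simp add: id_def)
  qed
next
  assume *: "\<forall>v\<in>span2 p q. eval_cubic id F v = 0"
  define L where "L = (\<lambda>e :: 4 \<Rightarrow> nat. \<Prod>i\<in>UNIV. [:p $ i, q $ i:] ^ e i)"
  define P where "P = (\<Sum>e\<in>mons3. [:F e:] * L e)"
  have P: "poly P t = eval_cubic id F (p + t *s q)" for t
    by (simp add: P_def L_def poly_sum poly_prod eval_cubic_def mult_ac)
  have "degree P \<le> 3"
    unfolding P_def
  proof (rule degree_sum_le[OF finite_mons3])
    fix e assume e: "e \<in> mons3"
    have "degree (L e) \<le> (\<Sum>i\<in>UNIV. degree ([:p $ i, q $ i:] ^ e i))"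
      unfolding L_def using degree_prod_sum_le[of "UNIV :: 4 set" "\<lambda>i. [:p $ i, q $ i:] ^ e i"] by (simp add: o_def)
    also have "\<dots> \<le> (\<Sum>i\<in>UNIV. e i)"
    proof (rule sum_mono)
      fix i
      have "degree [:p $ i, q $ i:] \<le> 1" by simp
      then show "degree ([:p $ i, q $ i:] ^ e i) \<le> e i"
        using degree_power_le[of "[:p $ i, q $ i:]" "e i"] by (metis le_trans mult_le_mono1 nat_mult_1)
    qed
    also have "\<dots> = 3" using e by (simp add: mons3_def)
    finally show "degree ([:F e:] * L e) \<le> 3"
      using degree_smult_le[of "F e" "L e"] by simp
  qed
  have "P = 0"
  proof (rule poly_eqI_degree[of UNIV])
    fix t
    have "p + t *s q = 1 *s p + t *s q" by simp
    then have "p + t *s q \<in> span2 p q" unfolding span2_def by blast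
    then show "poly P t = poly 0 t" using * P by (simp add: id_def)
  qed (use card \<open>degree P \<le> 3\<close> in auto)
  define p' q' where "p' = (\<chi> i. to_ac (p $ i))" and "q' = (\<chi> i. to_ac (q $ i))"
  have "eval_cubic to_ac F (p' + t *s q') = poly (map_poly to_ac P) t" for t
    by (simp add: P_def L_def map_poly_to_ac_sum map_poly_to_ac_mult map_poly_to_ac_prod
        map_poly_to_ac_power map_poly_to_ac_smult map_poly_pCons poly_sum poly_prod eval_cubic_def mult_ac p'_def q'_def)
  with \<open>P = 0\<close> have 0: "eval_cubic to_ac F (p' + t *s q') = 0" for t by simp
  \<comment> \<open>The affine chart \<open>p + t q\<close> misses only the point \<open>q\<close>
    of the line, which is rational and is checked separately.\<close>
  have "q = 0 *s p + 1 *s q" by simp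
  then have "q \<in> span2 p q" unfolding span2_def by blast
  with * have q: "eval_cubic to_ac F q' = 0"
    by (simp add: q'_def eval_cubic_to_ac)
  show "line_in_cubic F p q"
    unfolding line_in_cubic_def p'_def[symmetric] q'_def[symmetric]
  proof (intro allI)
    fix s t
    show "eval_cubic to_ac F (s *s p' + t *s q') = 0"
    proof (cases "s = 0")
      case True
      then show ?thesis using q by (simp add: eval_cubic_scale)
    next
      case False
      then have "s *s p' + t *s q' = s *s (p' + (t / s) *s q')"
        by (simp add: vec_eq_iff algebra_simps)
      then show ?thesis using 0 by (simp add: eval_cubic_scale)
    qed
  qed
qed

lemma k_lines_eq:
  fixes F :: "(4 \<Rightarrow> nat) \<Rightarrow> 'a::{finite,field}"
  assumes "CARD('a) \<ge> 4"
  shows "k_lines F = {span2 p q | p q. lin_indep2 p q \<and> (\<forall>v\<in>span2 p q. eval_cubic id F v = 0)}"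
  unfolding k_lines_def using line_in_cubic_iff[OF assms] by auto

text \<open>Squaring is injective in characteristic two, hence bijective on a finite field.\<close>
lemma char2_sqrt:
  fixes x :: "'a::{finite,field}"
  assumes "(2::'a) = 0"
  obtains y where "y ^ 2 = x"
proof -
  have "inj (\<lambda>y::'a. y ^ 2)"
  proof (rule injI)
    fix x y :: 'a assume *: "x ^ 2 = y ^ 2"
    have "(x - y) ^ 2 = x ^ 2 + y ^ 2 - 2 * x * y" by (simp add: power2_diff)
    also have "\<dots> = 2 * y ^ 2" using * assms by simp
    finally have "(x - y) ^ 2 = 0" using assms by simp
    then show "x = y" by simp
  qed
  then have "surj (\<lambda>y::'a. y ^ 2)" by (rule finite_UNIV_inj_surj[OF finite])
  then show ?thesis using that by (metis surjD)
qed

lemma char2_neg: "(2::'a::ring_1) = 0 \<Longrightarrow> - x = (x::'a)"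
proof -
  assume that: "(2::'a) = 0"
  have "x + x = (1 + 1) * x" by (simp only: distrib_right mult_1_left)
  also have "\<dots> = 0" using that by (simp add: one_add_one)
  finally show ?thesis by (simp add: minus_unique)
qed

lemma char2_of_CARD:
  assumes "CARD('a::{finite,field}) = 2 ^ d"
  shows "(2::'a) = 0"
proof -
  have "CHAR('a) dvd 2 ^ d"
    using CHAR_dvd_CARD[where 'a = 'a] assms by simp
  then have "of_nat (2 ^ d) = (0::'a)" by (simp only: of_nat_eq_0_iff_char_dvd)
  then show ?thesis by simp
qed

subsection \<open>Two-dimensional subspaces\<close>

lemma span2_comb: "u \<in> span2 p q \<Longrightarrow> v \<in> span2 p q \<Longrightarrow> a *s u + b *s v \<in> span2 p q"
proof -
  assume "u \<in> span2 p q" "v \<in> span2 p q"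
  then obtain s t s' t' where "u = s *s p + t *s q" "v = s' *s p + t' *s q"
    by (auto simp: span2_def)
  then have "a *s u + b *s v = (a * s + b * s') *s p + (a * t + b * t') *s q"
    by (simp add: vec_eq_iff algebra_simps)
  then show ?thesis unfolding span2_def by blast
qed

lemma span2_scale: "u \<in> span2 p q \<Longrightarrow> a *s u \<in> span2 p q"
  using span2_comb[of u p q u a 0] by simp

lemma span2_add: "u \<in> span2 p q \<Longrightarrow> v \<in> span2 p q \<Longrightarrow> u + v \<in> span2 p q"
  using span2_comb[of u p q v 1 1] by simp

lemma span2_diff: "u \<in> span2 p q \<Longrightarrow> v \<in> span2 p q \<Longrightarrow> u - v \<in> span2 p q"
  using span2_comb[of u p q v 1 "- 1"] by simp

lemma span2_generators: "p \<in> span2 p q" "q \<in> span2 p q"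
proof -
  have "p = 1 *s p + 0 *s q" "q = 0 *s p + 1 *s q" by simp_all
  then show "p \<in> span2 p q" "q \<in> span2 p q" unfolding span2_def by blast+
qed

lemma span2_subset: "u \<in> span2 p q \<Longrightarrow> v \<in> span2 p q \<Longrightarrow> span2 u v \<subseteq> span2 p q"
  unfolding span2_def[of u v] using span2_comb by blast

lemma lin_indep2D: "lin_indep2 p q \<Longrightarrow> a *s p + b *s q = 0 \<Longrightarrow> a = 0 \<and> b = 0"
  by (auto simp: lin_indep2_def)

lemma span2_eqI:
  assumes uv: "u \<in> span2 p q" "v \<in> span2 p q" and ind: "lin_indep2 u v"
  shows "span2 u v = span2 p q"
proof
  show "span2 u v \<subseteq> span2 p q" using uv by (rule span2_subset)
  obtain a b c d where u: "u = a *s p + b *s q" and v: "v = c *s p + d *s q"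
    using uv by (auto simp: span2_def)
  define D where "D = a * d - b * c"
  have "D \<noteq> 0"
  proof
    assume D: "D = 0"
    have "d *s u + (- b) *s v = 0" "c *s u + (- a) *s v = 0"
      using D by (simp_all add: u v vec_eq_iff D_def algebra_simps)
    then have "- b = 0" "- a = 0"
      using lin_indep2D[OF ind] by blast+
    then have "u = 0" by (simp add: u)
    then have "1 *s u + 0 *s v = 0" by simp
    then show False using ind unfolding lin_indep2_def by (metis one_neq_zero)
  qed
  have "D *s p = d *s u + (- b) *s v" "D *s q = (- c) *s u + a *s v"
    by (simp_all add: u v vec_eq_iff D_def algebra_simps)
  then have "p = inverse D *s (d *s u + (- b) *s v)" "q = inverse D *s ((- c) *s u + a *s v)"
    using \<open>D \<noteq> 0\<close> by (metis vector_smult_assoc left_inverse vector_smult_lid)+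
  then have "p \<in> span2 u v" "q \<in> span2 u v"
    using span2_scale[OF span2_comb[OF span2_generators(1)[of u v] span2_generators(2)[of v u]]]
    by metis+
  then show "span2 p q \<subseteq> span2 u v" by (rule span2_subset)
qed

text \<open>Projectively, a line meets every coordinate plane. An unknown line is thus intersected
  with planes on which the cubic form simplifies.\<close>

lemma span2_coord:
  fixes p q :: "'a::field ^ 4"
  assumes "lin_indep2 p q"
  obtains v :: "'a ^ 4" where "v \<in> span2 p q" "v \<noteq> 0" "v $ i = 0"
proof (cases "p $ i = 0 \<and> q $ i = 0")
  case True
  have "p \<noteq> 0" using lin_indep2D[OF assms, of 1 0] by auto
  with True show ?thesis using that[of p] span2_generators by blast
next
  case False
  let ?v = "(q $ i) *s p + (- (p $ i)) *s q"
  have "?v \<noteq> 0" using False lin_indep2D[OF assms, of "q $ i" "- (p $ i)"] by auto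
  moreover have "?v \<in> span2 p q" unfolding span2_def by blast
  moreover have "?v $ i = 0" by simp
  ultimately show ?thesis using that by blast
qed

text \<open>The minor of the coordinates \<open>i\<close>, \<open>j\<close> decides. If it vanishes,
  some nonzero combination is killed by both coordinates; otherwise Cramer's rule shows that the
  plane projects onto these two coordinates, so it is a graph over them.\<close>

lemma span2_coords_dichotomy:
  assumes "lin_indep2 p q"
  shows "(\<exists>v\<in>span2 p q. v \<noteq> 0 \<and> v $ i = 0 \<and> v $ j = 0) \<or>
         (\<forall>a b. \<exists>v\<in>span2 p q. v $ i = a \<and> v $ j = b)"
proof (cases "p $ i * q $ j - p $ j * q $ i = 0")
  case True
  let ?u = "(q $ i) *s p + (- (p $ i)) *s q"
  let ?v = "(q $ j) *s p + (- (p $ j)) *s q"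
  have "?u \<in> span2 p q" "?v \<in> span2 p q" unfolding span2_def by blast+
  moreover have "?u $ i = 0" "?u $ j = 0" "?v $ i = 0" "?v $ j = 0"
    using True by (simp_all add: algebra_simps)
  moreover have "?u \<noteq> 0 \<or> ?v \<noteq> 0 \<or> p $ i = 0 \<and> p $ j = 0"
    using lin_indep2D[OF assms, of "q $ i" "- (p $ i)"] lin_indep2D[OF assms, of "q $ j" "- (p $ j)"]
    by auto
  moreover have "p \<noteq> 0" using lin_indep2D[OF assms, of 1 0] by auto
  ultimately show ?thesis using span2_generators[of p q] by metis
next
  case False
  define D where "D = p $ i * q $ j - p $ j * q $ i"
  have "\<exists>v\<in>span2 p q. v $ i = a \<and> v $ j = b" for a b
  proof
    let ?v = "((a * q $ j - b * q $ i) / D) *s p + ((b * p $ i - a * p $ j) / D) *s q"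
    show "?v \<in> span2 p q" unfolding span2_def by blast
    show "?v $ i = a \<and> ?v $ j = b"
      using False by (simp add: divide_simps flip: D_def) (simp add: D_def algebra_simps)
  qed
  then show ?thesis by blast
qed

lemma span2_extend:
  assumes "lin_indep2 p q" "v \<in> span2 p q" "v \<noteq> 0"
  obtains u where "u \<in> span2 p q" "lin_indep2 v u" "span2 v u = span2 p q"
proof -
  obtain a b where v: "v = a *s p + b *s q" using assms(2) by (auto simp: span2_def)
  have "\<exists>u\<in>span2 p q. lin_indep2 v u"
  proof (cases "a = 0")
    case True
    then have "b \<noteq> 0" using assms(3) v by auto
    have "lin_indep2 v p"
      unfolding lin_indep2_def
    proof (intro allI impI)
      fix s t assume "s *s v + t *s p = 0"
      then have "t *s p + (s * b) *s q = 0" by (simp add: v True add.commute vector_smult_assoc)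
      then show "s = 0 \<and> t = 0" using lin_indep2D[OF assms(1)] \<open>b \<noteq> 0\<close> by force
    qed
    then show ?thesis using span2_generators by blast
  next
    case False
    have "lin_indep2 v q"
      unfolding lin_indep2_def
    proof (intro allI impI)
      fix s t assume "s *s v + t *s q = 0"
      then have "(s * a) *s p + (s * b + t) *s q = 0"
        by (simp add: v vec_eq_iff algebra_simps)
      then have "s * a = 0 \<and> s * b + t = 0" using lin_indep2D[OF assms(1)] by blast
      then show "s = 0 \<and> t = 0" using False by auto
    qed
    then show ?thesis using span2_generators by blast
  qed
  then show ?thesis using that span2_eqI assms(2) by metis
qed

section \<open>Vanishing criteria and missed values over a finite field\<close>

lemma ex_not_0_1:
  assumes "CARD('a::{finite,field}) \<ge> 4"
  obtains e :: "'a::{finite,field}" where "e \<noteq> 0" "e \<noteq> 1"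
proof -
  have "\<exists>e :: 'a. e \<notin> {0, 1}"
  proof (rule ccontr)
    assume "\<nexists>e :: 'a. e \<notin> {0, 1}"
    then have "UNIV = {0, 1 :: 'a}" by blast
    then have "CARD('a) = card {0, 1 :: 'a}" by simp
    then show False using assms by simp
  qed
  then show ?thesis using that by blast
qed

text \<open>The three arguments 0, 1, e suffice for degree two. The typical use is
  \<open>F(u + s v)\<close> with \<open>v\<close> on the surface, where the term in
  \<open>s^3\<close> drops out.\<close>

lemma quadratic_vanishes:
  fixes A B C :: "'a::{finite,field}"
  assumes "CARD('a) \<ge> 4" and *: "\<And>s. A * s ^ 2 + B * s + C = 0"
  shows "A = 0 \<and> B = 0 \<and> C = 0"
proof -
  obtain e :: 'a where e: "e \<noteq> 0" "e \<noteq> 1" by (rule ex_not_0_1[OF assms(1)])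
  have "C = 0" using *[of 0] by simp
  moreover have "B = - A" using *[of 1] \<open>C = 0\<close> by (simp add: eq_neg_iff_add_eq_0 add.commute)
  moreover have "A * (e * (e - 1)) = 0"
    using *[of e] \<open>C = 0\<close> \<open>B = - A\<close> by (simp add: algebra_simps power2_eq_square)
  ultimately show ?thesis using e by simp
qed

text \<open>Source of the constants \<open>b\<close>, \<open>c\<close>, \<open>f\<close> of the
  construction: on a finite set a map that is not injective is not surjective, so one coincidence of
  values yields a polynomial without roots.\<close>

lemma noninjective_misses_value:
  fixes f :: "'a::{finite,field} \<Rightarrow> 'a"
  assumes "f a = f b" "a \<noteq> b"
  obtains c where "\<And>t. f t \<noteq> c"
proof -
  have "\<not> inj f" using assms by (auto simp: inj_def)
  then have "\<not> surj f" using finite_UNIV_surj_inj[OF finite] by blast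
  then show ?thesis using that by (metis surjI surj_def)
qed

lemma k_linesI:
  fixes F :: "(4 \<Rightarrow> nat) \<Rightarrow> 'a::{finite,field}"
  assumes "CARD('a) \<ge> 4" "lin_indep2 p q" "\<And>s t. eval_cubic id F (s *s p + t *s q) = 0"
  shows "span2 p q \<in> k_lines F"
proof -
  have "\<forall>v\<in>span2 p q. eval_cubic id F v = 0" using assms(3) by (auto simp: span2_def)
  then show ?thesis unfolding k_lines_eq[OF assms(1)] using assms(2) by blast
qed

lemma char2_alg_closure: "(2::'a::field) = 0 \<Longrightarrow> (2 :: 'a alg_closure) = 0"
  by (metis to_ac_0 to_ac_numeral)

lemma char2_diff: "(2::'a::comm_ring_1) = 0 \<Longrightarrow> a - b = a + (b :: 'a)"
  using char2_neg[of b] by (metis diff_conv_add_uminus)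

lemma char2_three: "(2::'a::comm_ring_1) = 0 \<Longrightarrow> (3::'a) = 1"
proof -
  assume "(2::'a) = 0"
  have "(3::'a) = 2 + 1" by simp
  with \<open>2 = 0\<close> show ?thesis by simp
qed

lemmas eval_sparse_simps =
  eval_sparse_form eval_partial_sparse_form prod_4

text \<open>The form is the norm form of the quadratic extension defined by
  \<open>t^2 + t + c\<close>; a zero with \<open>w\<close> nonzero would give the root
  \<open>z / w\<close>.\<close>

lemma anisotropic_quadratic:
  fixes c :: "'a::field"
  assumes c: "\<And>t. t ^ 2 + t \<noteq> - c" and *: "z ^ 2 + z * w + c * w ^ 2 = 0"
  shows "z = 0 \<and> w = 0"
proof (cases "w = 0")
  case False
  have "(z / w) ^ 2 + z / w + c = (z ^ 2 + z * w + c * w ^ 2) / w ^ 2"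
    using False by (simp add: field_simps power2_eq_square)
  then show ?thesis using c[of "z / w"] * by (simp add: eq_neg_iff_add_eq_0)
qed (use * in auto)

subsection \<open>Surfaces with zero, one and three lines\<close>

definition cubic_0 :: "'a::field \<Rightarrow> (4 \<Rightarrow> nat) \<Rightarrow> 'a" where
  "cubic_0 c = sparse_form [(1, mono4 2 1 0 0), (1, mono4 1 2 0 0), (1, mono4 0 0 3 0),
     (1, mono4 0 0 1 2), (c, mono4 0 0 0 3)]"

lemma eval_cubic_0:
  "eval_cubic id (cubic_0 c) v = v $ 1 ^ 2 * v $ 2 + v $ 1 * v $ 2 ^ 2
     + (v $ 3 ^ 3 + v $ 3 * v $ 4 ^ 2 + c * v $ 4 ^ 3)"
  by (simp add: cubic_0_def eval_sparse_simps algebra_simps)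

lemma smooth_cubic_0:
  fixes c :: "'a::field"
  assumes char2: "(2::'a) = 0" and "c \<noteq> 0"
  shows "smooth_cubic (cubic_0 c)"
proof -
  note two = char2_alg_closure[OF char2]
  note three = char2_three[OF two]
  have "x = 0" if "\<forall>j. eval_partial to_ac (cubic_0 c) j x = 0" for x :: "'a alg_closure ^ 4"
  proof -
    from that have "x $ 1 = 0" "x $ 2 = 0" "x $ 3 ^ 2 + x $ 4 ^ 2 = 0" "to_ac c * x $ 4 ^ 2 = 0"
      by (auto simp: cubic_0_def eval_sparse_simps forall_4 two three)
    then show ?thesis using \<open>c \<noteq> 0\<close> by (auto simp: vec4_eq_iff)
  qed
  moreover have "cubic_0 c (mono4 2 1 0 0) \<noteq> 0" by (simp add: cubic_0_def)
  ultimately show ?thesis unfolding smooth_cubic_def by fastforce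
qed

text \<open>The form is \<open>xy(x + y) + N(z, w)\<close> with \<open>N\<close> anisotropic. In the
  plane x = 0 it reduces to \<open>N\<close>, so a rational line meets this plane in (0:1:0:0), and
  likewise y = 0 in (1:0:0:0). Only z = w = 0 joins these points, and \<open>xy(x + y)\<close> does
  not vanish on it once k has an element besides 0 and 1.\<close>

lemma k_lines_cubic_0:
  fixes c :: "'a::{finite,field}"
  assumes card: "CARD('a) \<ge> 4" and c: "\<And>t. t ^ 3 + t \<noteq> - c"
  shows "k_lines (cubic_0 c) = {}"
proof -
  have aniso: "z = 0 \<and> w = 0" if *: "z ^ 3 + z * w ^ 2 + c * w ^ 3 = 0" for z w
  proof (cases "w = 0")
    case False
    have "(z / w) ^ 3 + z / w + c = (z ^ 3 + z * w ^ 2 + c * w ^ 3) / w ^ 3"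
      using False by (simp add: field_simps power2_eq_square power3_eq_cube)
    then show ?thesis using c[of "z / w"] * by (simp add: eq_neg_iff_add_eq_0)
  qed (use * in auto)
  obtain e :: 'a where e: "e \<noteq> 0" "e \<noteq> 1" by (rule ex_not_0_1[OF card])
  have False if ind: "lin_indep2 p q" and 0: "\<forall>v\<in>span2 p q. eval_cubic id (cubic_0 c) v = 0" for p q
  proof -
    obtain u where u: "u \<in> span2 p q" "u \<noteq> 0" "u $ 1 = 0" using span2_coord[OF ind] by metis
    have u': "u $ 3 = 0 \<and> u $ 4 = 0" using 0 u aniso[of "u $ 3" "u $ 4"] by (auto simp: eval_cubic_0)
    obtain v where v: "v \<in> span2 p q" "v \<noteq> 0" "v $ 2 = 0" using span2_coord[OF ind] by metis
    have v': "v $ 3 = 0 \<and> v $ 4 = 0" using 0 v aniso[of "v $ 3" "v $ 4"] by (auto simp: eval_cubic_0)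
    have nz: "u $ 2 \<noteq> 0" "v $ 1 \<noteq> 0" using u v u' v' by (auto simp: vec4_eq_iff)
    \<comment> \<open>This is the point (1, -e, 0, 0), where the form takes the value
      \<open>e (e - 1)\<close>.\<close>
    let ?x = "(- e / u $ 2) *s u + (1 / v $ 1) *s v"
    have "eval_cubic id (cubic_0 c) ?x = 0" using 0 span2_comb u v by blast
    then have "e * (e - 1) = 0" using u v u' v' nz
      by (simp add: eval_cubic_0 power2_eq_square algebra_simps)
    then show False using e by simp
  qed
  then show ?thesis unfolding k_lines_eq[OF card] by blast
qed

definition cubic_3 :: "'a::field \<Rightarrow> (4 \<Rightarrow> nat) \<Rightarrow> 'a" where
  "cubic_3 c = sparse_form [(1, mono4 2 1 0 0), (1, mono4 1 2 0 0), (1, mono4 0 0 2 1),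
     (1, mono4 0 0 1 2), (c, mono4 0 0 0 3)]"

lemma eval_cubic_3:
  "eval_cubic id (cubic_3 c) v = v $ 1 * v $ 2 * (v $ 1 + v $ 2)
     + v $ 4 * (v $ 3 ^ 2 + v $ 3 * v $ 4 + c * v $ 4 ^ 2)"
  by (simp add: cubic_3_def eval_sparse_simps algebra_simps power2_eq_square power3_eq_cube)

lemma smooth_cubic_3:
  fixes c :: "'a::field"
  assumes char2: "(2::'a) = 0"
  shows "smooth_cubic (cubic_3 c)"
proof -
  note two = char2_alg_closure[OF char2]
  have "x = 0" if "\<forall>j. eval_partial to_ac (cubic_3 c) j x = 0" for x :: "'a alg_closure ^ 4"
  proof -
    from that have "x $ 1 = 0" "x $ 2 = 0" "x $ 4 = 0" "x $ 3 ^ 2 + to_ac c * (3 * x $ 4 ^ 2) = 0"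
      by (auto simp: cubic_3_def eval_sparse_simps forall_4 two)
    then show ?thesis by (auto simp: vec4_eq_iff)
  qed
  moreover have "cubic_3 c (mono4 2 1 0 0) \<noteq> 0" by (simp add: cubic_3_def)
  ultimately show ?thesis unfolding smooth_cubic_def by fastforce
qed

text \<open>The form is \<open>xy(x + y) + w N(z, w)\<close> with \<open>N\<close> anisotropic. The
  three lines are the section by w = 0, concurrent in the Eckardt point (0:0:1:0). A rational line
  has w = 0 wherever it meets x = 0, y = 0 or x = y; this forces it through the Eckardt point and
  then into the tangent plane w = 0 there.\<close>

lemma k_lines_cubic_3:
  fixes c :: "'a::{finite,field}"
  assumes card: "CARD('a) \<ge> 4" and char2: "(2::'a) = 0" and c: "\<And>t. t ^ 2 + t \<noteq> - c"
  shows "k_lines (cubic_3 c) =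
    {span2 (vec4 0 0 1 0) (vec4 1 0 0 0), span2 (vec4 0 0 1 0) (vec4 0 1 0 0),
     span2 (vec4 0 0 1 0) (vec4 1 1 0 0)}" (is "_ = {?L1, ?L2, ?L3}")
proof
  note neg = char2_neg[OF char2]
  have "c \<noteq> 0" using c[of 0] by auto
  obtain e :: 'a where e: "e \<noteq> 0" "e \<noteq> 1" by (rule ex_not_0_1[OF card])
  show "k_lines (cubic_3 c) \<subseteq> {?L1, ?L2, ?L3}"
  proof
    fix l assume "l \<in> k_lines (cubic_3 c)"
    then obtain p q where l: "l = span2 p q" and ind: "lin_indep2 p q"
      and 0: "\<And>v. v \<in> span2 p q \<Longrightarrow> eval_cubic id (cubic_3 c) v = 0"
      unfolding k_lines_eq[OF card] by blast
    have w0: "v $ 4 = 0" if "v \<in> span2 p q" "v $ 1 = 0 \<or> v $ 2 = 0 \<or> v $ 1 = v $ 2" for v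
    proof -
      have "v $ 1 * v $ 2 * (v $ 1 + v $ 2) = 0" using that(2) neg[of "v $ 2"] by auto
      then show ?thesis
        using 0[OF that(1)] anisotropic_quadratic[OF c, of "v $ 3" "v $ 4"] by (auto simp: eval_cubic_3)
    qed
    have "\<exists>u\<in>span2 p q. u \<noteq> 0 \<and> u $ 1 = 0 \<and> u $ 2 = 0"
    proof (rule ccontr)
      assume "\<not> ?thesis"
      then have *: "\<exists>v\<in>span2 p q. v $ 1 = a \<and> v $ 2 = b" for a b
        using span2_coords_dichotomy[OF ind, of 1 2] by blast
      obtain u v where uv: "u \<in> span2 p q" "u $ 1 = 1" "u $ 2 = 0" "v \<in> span2 p q" "v $ 1 = 0" "v $ 2 = 1"
        using * by metis
      \<comment> \<open>Both \<open>u\<close> and \<open>v\<close> have w = 0, so only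
        \<open>xy(x + y)\<close> survives at the point with (x, y) = (e, 1), and it is nonzero
        there.\<close>
      let ?x = "e *s u + 1 *s v"
      have "?x \<in> span2 p q" using span2_comb uv by blast
      then have "eval_cubic id (cubic_3 c) ?x = 0" by (rule 0)
      moreover have "u $ 4 = 0" "v $ 4 = 0" using w0 uv by auto
      ultimately have "e * (e - (- 1)) = 0" using uv by (simp add: eval_cubic_3)
      then show False using e by (simp add: neg)
    qed
    then obtain u where u: "u \<in> span2 p q" "u \<noteq> 0" "u $ 1 = 0" "u $ 2 = 0" by blast
    then have u4: "u $ 4 = 0" using w0 by blast
    then have u3: "u $ 3 \<noteq> 0" using u by (auto simp: vec4_eq_iff)
    have e3: "vec4 0 0 1 0 \<in> span2 p q"
    proof -
      have "vec4 0 0 1 0 = (1 / u $ 3) *s u" using u u4 u3 by (simp add: vec4_eq_iff)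
      then show ?thesis using span2_scale u by metis
    qed
    obtain v where v: "v \<in> span2 p q" "lin_indep2 (vec4 0 0 1 0) v"
      using span2_extend[OF ind e3] by (metis vec4_nth(3) zero_index zero_neq_one)
    define v' where "v' = v - v $ 3 *s vec4 0 0 1 0"
    have v': "v' \<in> span2 p q" "v' $ 3 = 0"
      unfolding v'_def using v e3 by (auto intro: span2_diff span2_scale)
    have v'0: "v' \<noteq> 0"
    proof
      assume "v' = 0"
      then have "(- (v $ 3)) *s vec4 0 0 1 0 + 1 *s v = 0" by (simp add: v'_def add.commute)
      then show False using lin_indep2D[OF v(2)] by (metis one_neq_zero)
    qed
    \<comment> \<open>The tangent condition: moving along the line from \<open>v'\<close> towards
      (0:0:1:0), the coefficient of \<open>s^2\<close> is the w-coordinate of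
      \<open>v'\<close>.\<close>
    have "v' $ 4 = 0"
    proof -
      have "v' $ 4 * s ^ 2 + v' $ 4 ^ 2 * s + eval_cubic id (cubic_3 c) v' = 0" for s
      proof -
        have "v' + s *s vec4 0 0 1 0 \<in> span2 p q" using v' e3 by (auto intro: span2_add span2_scale)
        from 0[OF this] show ?thesis using v' by (simp add: eval_cubic_3 algebra_simps power2_eq_square)
      qed
      then show ?thesis using quadratic_vanishes[OF card] by blast
    qed
    then have "v' $ 1 * v' $ 2 * (v' $ 1 + v' $ 2) = 0" using 0[OF v'(1)] by (simp add: eval_cubic_3)
    then have *: "v' $ 1 = 0 \<or> v' $ 2 = 0 \<or> v' $ 1 = v' $ 2"
      by (auto simp: add_eq_0_iff neg)
    have mem: "w \<in> span2 p q" if "v' = a *s w" "a \<noteq> 0" for a w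
    proof -
      have "w = (1 / a) *s v'" using that by (simp add: vec_eq_iff)
      then show ?thesis using span2_scale v' by metis
    qed
    have "vec4 1 0 0 0 \<in> span2 p q \<or> vec4 0 1 0 0 \<in> span2 p q \<or> vec4 1 1 0 0 \<in> span2 p q"
      using * mem[of "v' $ 1" "vec4 1 0 0 0"] mem[of "v' $ 2" "vec4 0 1 0 0"] mem[of "v' $ 1" "vec4 1 1 0 0"]
        v'0 v'(2) \<open>v' $ 4 = 0\<close> by (auto simp: vec4_eq_iff)
    moreover have "lin_indep2 (vec4 0 0 1 0) (vec4 1 0 0 0 :: 'a ^ 4)"
      "lin_indep2 (vec4 0 0 1 0) (vec4 0 1 0 0 :: 'a ^ 4)"
      "lin_indep2 (vec4 0 0 1 0) (vec4 1 1 0 0 :: 'a ^ 4)"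
      by (auto simp: lin_indep2_def vec4_eq_iff)
    ultimately show "l \<in> {?L1, ?L2, ?L3}" unfolding l
      using span2_eqI[OF e3, of "vec4 1 0 0 0"] span2_eqI[OF e3, of "vec4 0 1 0 0"]
        span2_eqI[OF e3, of "vec4 1 1 0 0"] by auto
  qed
  show "{?L1, ?L2, ?L3} \<subseteq> k_lines (cubic_3 c)"
  proof -
    have "span2 (vec4 0 0 1 0) (vec4 a b 0 0) \<in> k_lines (cubic_3 c)"
      if "(a, b) \<in> {(1, 0), (0, 1), (1, 1)}" for a b :: 'a
    proof (rule k_linesI[OF card])
      show "lin_indep2 (vec4 0 0 1 0) (vec4 a b 0 0)"
        using that by (auto simp: lin_indep2_def vec4_eq_iff)
      show "eval_cubic id (cubic_3 c) (s *s vec4 0 0 1 0 + t *s vec4 a b 0 0) = 0" for s t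
        using that by (auto simp: eval_cubic_3 add_eq_0_iff neg)
    qed
    then show ?thesis by blast
  qed
qed

lemma card_k_lines_cubic_3:
  fixes c :: "'a::{finite,field}"
  assumes "CARD('a) \<ge> 4" and "(2::'a) = 0" and "\<And>t. t ^ 2 + t \<noteq> - c"
  shows "card (k_lines (cubic_3 c)) = 3"
proof -
  have mem: "vec4 a b 0 0 \<in> span2 (vec4 0 0 1 0) (vec4 a' b' 0 0) \<longleftrightarrow> (\<exists>t. a = t * a' \<and> b = t * b')"
    for a b a' b' :: 'a
    by (auto simp: span2_def vec4_eq_iff)
  have "vec4 a b 0 0 \<in> span2 (vec4 0 0 1 0) (vec4 a b 0 0)" for a b :: 'a
    by (rule span2_generators)
  then have "span2 (vec4 0 0 1 0) (vec4 a b 0 0) \<noteq> span2 (vec4 0 0 1 0) (vec4 a' b' 0 0)"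
    if "\<nexists>t. a = t * a' \<and> b = t * b'" for a b a' b' :: 'a
    using mem that by metis
  then show ?thesis unfolding k_lines_cubic_3[OF assms] by (subst card_insert_disjoint) auto
qed

text \<open>The plane $w = 0$ meets this surface in the line $z = w = 0$ and two conjugate lines. A further
  rational line would have to meet $z = w = 0$, but the other planes through that line contain no
  rational line: for $z = \<lambda> w$ with $\<lambda> \<noteq> 0$ the residual conic has
  discriminant $\<lambda> (f \<lambda>^3 + c \<lambda> + 1) \<noteq> 0$, and for $z = 0$ it is $y^2 + y w + c w^2$.\<close>
definition cubic_1 :: "'a::field \<Rightarrow> 'a \<Rightarrow> (4 \<Rightarrow> nat) \<Rightarrow> 'a" where
  "cubic_1 c f = sparse_form [(1, mono4 2 0 1 0), (1, mono4 1 1 1 0), (c, mono4 0 2 1 0),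
     (1, mono4 0 2 0 1), (1, mono4 0 1 0 2), (c, mono4 0 0 0 3), (f, mono4 0 0 2 1)]"

lemma eval_cubic_1:
  "eval_cubic id (cubic_1 c f) v = v $ 3 * (v $ 1 ^ 2 + v $ 1 * v $ 2 + c * v $ 2 ^ 2)
     + v $ 4 * (v $ 2 ^ 2 + v $ 2 * v $ 4 + c * v $ 4 ^ 2 + f * v $ 3 ^ 2)"
  by (simp add: cubic_1_def eval_sparse_simps algebra_simps power2_eq_square power3_eq_cube)

lemma smooth_cubic_1:
  fixes c f :: "'a::field"
  assumes char2: "(2::'a) = 0" and "f \<noteq> 0"
  shows "smooth_cubic (cubic_1 c f)"
proof -
  note two = char2_alg_closure[OF char2]
  have "x = 0" if "\<forall>j. eval_partial to_ac (cubic_1 c f) j x = 0" for x :: "'a alg_closure ^ 4"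
  proof -
    from that have "x $ 2 * x $ 3 = 0" "x $ 1 * x $ 3 + x $ 4 ^ 2 = 0"
      "x $ 1 ^ 2 + (x $ 1 * x $ 2 + to_ac c * x $ 2 ^ 2) = 0"
      "x $ 2 ^ 2 + (to_ac c * (3 * x $ 4 ^ 2) + to_ac f * x $ 3 ^ 2) = 0"
      by (auto simp: cubic_1_def eval_sparse_simps forall_4 two)
    then show ?thesis using \<open>f \<noteq> 0\<close> by (auto simp: vec4_eq_iff)
  qed
  moreover have "cubic_1 c f (mono4 2 0 1 0) \<noteq> 0" by (simp add: cubic_1_def)
  ultimately show ?thesis unfolding smooth_cubic_def by fastforce
qed

text \<open>A rational line meets w = 0 either in (0:0:1:0) or on z = w = 0. The first is
  impossible, and in the second case the expansion of the form along the line expresses a root of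
  one of the excluded polynomials.\<close>

lemma k_lines_cubic_1:
  fixes c f :: "'a::{finite,field}"
  assumes card: "CARD('a) \<ge> 4" and char2: "(2::'a) = 0"
    and c: "\<And>t. t ^ 2 + t \<noteq> - c" and f: "\<And>t. t ^ 3 + c * t ^ 2 \<noteq> - f"
  shows "k_lines (cubic_1 c f) = {span2 (vec4 1 0 0 0) (vec4 0 1 0 0)}" (is "_ = {?L}")
proof
  note neg = char2_neg[OF char2]
  have f0: "f \<noteq> 0" using f[of 0] by auto
  note aniso = anisotropic_quadratic[OF c]
  have indL: "lin_indep2 (vec4 1 0 0 0) (vec4 0 1 0 0 :: 'a ^ 4)"
    by (auto simp: lin_indep2_def vec4_eq_iff)
  have inL: "v \<in> ?L" if "v $ 3 = 0" "v $ 4 = 0" for v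
  proof -
    have "v = v $ 1 *s vec4 1 0 0 0 + v $ 2 *s vec4 0 1 0 0" using that by (simp add: vec4_eq_iff)
    then show ?thesis unfolding span2_def by blast
  qed
  show "k_lines (cubic_1 c f) \<subseteq> {?L}"
  proof
    fix l assume "l \<in> k_lines (cubic_1 c f)"
    then obtain p q where l: "l = span2 p q" and ind: "lin_indep2 p q"
      and 0: "\<And>v. v \<in> span2 p q \<Longrightarrow> eval_cubic id (cubic_1 c f) v = 0"
      unfolding k_lines_eq[OF card] by blast
    obtain v where v: "v \<in> span2 p q" "v \<noteq> 0" "v $ 4 = 0" using span2_coord[OF ind] by metis
    obtain u where u: "u \<in> span2 p q" "lin_indep2 v u" "span2 v u = span2 p q"
      using span2_extend[OF ind v(1,2)] by metis
    have 1: "eval_cubic id (cubic_1 c f) (u + s *s v) = 0" for s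
      using 0 u v by (auto intro: span2_add span2_scale)
    have "v $ 3 = 0 \<or> v $ 1 = 0 \<and> v $ 2 = 0"
      using 0[OF v(1)] v(3) aniso[of "v $ 1" "v $ 2"] by (auto simp: eval_cubic_1)
    \<comment> \<open>The point is (0:0:1:0), whose tangent plane is w = 0; the coefficient of
      \<open>s^2\<close> forces the line into it, where only the two conjugate lines pass through
      the point.\<close>
    moreover have False if v12: "v $ 1 = 0" "v $ 2 = 0"
    proof -
      have v3: "v $ 3 \<noteq> 0" using v v12 by (auto simp: vec4_eq_iff)
      let ?N = "u $ 1 ^ 2 + u $ 1 * u $ 2 + c * u $ 2 ^ 2"
      have "(u $ 4 * f * v $ 3 ^ 2) * s ^ 2 + (v $ 3 * ?N + 2 * u $ 4 * f * u $ 3 * v $ 3) * s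
        + eval_cubic id (cubic_1 c f) u = 0" for s
        using 1[of s] v12 v(3) by (simp add: eval_cubic_1 algebra_simps power2_eq_square)
      from quadratic_vanishes[OF card this] have u4: "u $ 4 = 0" and "?N = 0"
        using v3 f0 by (auto simp: char2)
      then have "(- (u $ 3 / v $ 3)) *s v + 1 *s u = 0"
        using aniso[of "u $ 1" "u $ 2"] v12 v(3) v3 by (simp add: vec4_eq_iff)
      then show False using lin_indep2D[OF u(2)] one_neq_zero by blast
    qed
    ultimately have v3: "v $ 3 = 0" by blast
    show "l \<in> {?L}"
    proof (cases "u $ 3 = 0 \<and> u $ 4 = 0")
      case True
      then have "span2 v u = ?L" using u(2) v(3) v3 inL by (intro span2_eqI) auto
      then show ?thesis using l u by simp
    next
      case False
      have "(u $ 3 * (v $ 1 ^ 2 + v $ 1 * v $ 2 + c * v $ 2 ^ 2) + u $ 4 * v $ 2 ^ 2) * s ^ 2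
         + (u $ 3 * (2 * u $ 1 * v $ 1 + u $ 1 * v $ 2 + u $ 2 * v $ 1 + 2 * c * u $ 2 * v $ 2)
         + u $ 4 * (2 * u $ 2 * v $ 2 + u $ 4 * v $ 2)) * s + eval_cubic id (cubic_1 c f) u = 0" for s
        using 1[of s] v3 v(3) by (simp add: eval_cubic_1 algebra_simps power2_eq_square)
      from quadratic_vanishes[OF card this]
      have s2: "u $ 3 * (v $ 1 ^ 2 + v $ 1 * v $ 2 + c * v $ 2 ^ 2) + u $ 4 * v $ 2 ^ 2 = 0"
        and s1: "u $ 3 * (u $ 1 * v $ 2 + u $ 2 * v $ 1) + u $ 4 * (u $ 4 * v $ 2) = 0"
        by (simp_all add: char2)
      have u30: "u $ 3 \<noteq> 0"
      proof
        assume u3: "u $ 3 = 0"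
        with 0[OF u(1)] False have "u $ 2 ^ 2 + u $ 2 * u $ 4 + c * u $ 4 ^ 2 = 0"
          by (auto simp: eval_cubic_1)
        then show False using aniso False u3 by blast
      qed
      have v20: "v $ 2 \<noteq> 0"
      proof
        assume "v $ 2 = 0"
        with s2 u30 have "v $ 1 = 0" by simp
        with \<open>v $ 2 = 0\<close> v v3 show False by (auto simp: vec4_eq_iff)
      qed
      define x where "x = v $ 1 / v $ 2"
      define w where "w = u $ 4 / u $ 3"
      \<comment> \<open>The point of the line with second coordinate 0, scaled to third coordinate
        1. The linear coefficient \<open>s1\<close> then makes it (w^2, 0, 1, w), so that the cubic
        form becomes \<open>w (w^3 + c w^2 + f)\<close>.\<close>
      define y where "y = (1 / u $ 3) *s u + (- (u $ 2 / (u $ 3 * v $ 2))) *s v"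
      have y: "y $ 2 = 0" "y $ 3 = 1" "y $ 4 = w" "y $ 1 = (u $ 1 * v $ 2 - u $ 2 * v $ 1) / (u $ 3 * v $ 2)"
        using v v3 u30 v20 by (simp_all add: y_def w_def field_simps)
      have "u $ 3 * (u $ 1 * v $ 2 - u $ 2 * v $ 1) + u $ 4 * (u $ 4 * v $ 2) = 0"
        using s1 by (simp only: char2_diff[OF char2])
      then have *: "u $ 3 * (u $ 1 * v $ 2 - u $ 2 * v $ 1) = u $ 4 * (u $ 4 * v $ 2)"
        using neg[of "u $ 4 * (u $ 4 * v $ 2)"] by (simp only: eq_neg_iff_add_eq_0[symmetric])
      have "y $ 1 = (u $ 3 * (u $ 1 * v $ 2 - u $ 2 * v $ 1)) / (u $ 3 * (u $ 3 * v $ 2))"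
        unfolding y(4) using u30 by simp
      also have "\<dots> = w ^ 2"
        unfolding * using u30 v20 by (simp add: w_def field_simps power2_eq_square)
      finally have y1: "y $ 1 = w ^ 2" .
      have "y \<in> span2 p q" unfolding y_def using u v by (intro span2_comb)
      from 0[OF this] have "w * (w ^ 3 + c * w ^ 2 + f) = 0"
        using y(1-3) y1 by (simp add: eval_cubic_1 algebra_simps power2_eq_square power3_eq_cube)
      then have "w = 0" using f[of w] by (auto simp: eq_neg_iff_add_eq_0)
      moreover have "x ^ 2 + x + c + w = 0"
      proof -
        have "x ^ 2 + x + c + w = (u $ 3 * (v $ 1 ^ 2 + v $ 1 * v $ 2 + c * v $ 2 ^ 2) + u $ 4 * v $ 2 ^ 2) / (u $ 3 * v $ 2 ^ 2)"
          using u30 v20 by (simp add: x_def w_def field_simps power2_eq_square)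
        then show ?thesis using s2 by simp
      qed
      ultimately show ?thesis using c[of x] by (simp add: eq_neg_iff_add_eq_0)
    qed
  qed
  show "{?L} \<subseteq> k_lines (cubic_1 c f)"
    using k_linesI[OF card indL] by (simp add: eval_cubic_1)
qed

subsection \<open>The surface of a binary quintic form\<close>

lemma char2_add_self: "(2::'a::comm_ring_1) = 0 \<Longrightarrow> x + x = (0::'a)"
  using char2_neg[of x] by (metis add.right_inverse)

lemma char2_add_eq_0_iff: "(2::'a::comm_ring_1) = 0 \<Longrightarrow> x + y = 0 \<longleftrightarrow> x = (y::'a)"
  using char2_neg[of y] by (metis add_eq_0_iff2)

lemma cubic_vanishes:
  fixes A B C D :: "'a::{finite,field}"
  assumes card: "CARD('a) \<ge> 4" and *: "\<And>s t. A * s ^ 3 + B * s ^ 2 * t + C * s * t ^ 2 + D * t ^ 3 = 0"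
  shows "A = 0 \<and> B = 0 \<and> C = 0 \<and> D = 0"
proof -
  have "A = 0" using *[of 1 0] by simp
  moreover have "D = 0" using *[of 0 1] by simp
  moreover have "B * s ^ 2 + C * s + 0 = 0" for s
    using *[of s 1] \<open>A = 0\<close> \<open>D = 0\<close> by simp
  ultimately show ?thesis using quadratic_vanishes[OF card] by blast
qed

text \<open>Put \<open>g = W T^2 + Z\<close>. Then
  \<open>W^2 h(T) = T q1(W T^2, W) + q2(W T^2, W)\<close>, and \<open>W T^2 = g + Z\<close> in
  characteristic two. Expanding, the part without the factor \<open>g\<close> is
  \<open>T q1(Z, W) + q2(Z, W)\<close>.\<close>

lemma graph_identity:
  fixes T Z W :: "'r::comm_ring_1"
  assumes "(2::'r) = 0"
  shows "W ^ 2 * (a0 + a1 * T + a2 * T ^ 2 + a3 * T ^ 3 + a4 * T ^ 4 + a5 * T ^ 5) =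
    (W * T ^ 2 + Z) * ((a5 * T + a4) * (W * T ^ 2 + Z) + (a3 * T + a2) * W)
    + (T * (a5 * Z ^ 2 + a3 * Z * W + a1 * W ^ 2) + (a4 * Z ^ 2 + a2 * Z * W + a0 * W ^ 2))"
    (is "?l = ?r")
proof -
  have "?r - ?l = 2 * ((a5 * T + a4) * (W * T ^ 2 * Z + Z ^ 2) + (a3 * T + a2) * W * Z)"
    by (simp add: algebra_simps power_numeral_reduce)
  with assms show ?thesis by simp
qed

text \<open>The quintic form is given by its dehomogenization, of degree four or five; degree four means that
  the point at infinity is a root.\<close>
locale quintic_cubic =
  fixes a0 a1 a2 a3 a4 a5 :: "'a::{finite,field}"
  assumes card: "CARD('a) \<ge> 4" and char2: "(2::'a) = 0"
    and squarefree: "squarefree [:a0, a1, a2, a3, a4, a5:]"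
    and lead: "a4 \<noteq> 0 \<or> a5 \<noteq> 0"
begin

definition h where "h = [:a0, a1, a2, a3, a4, a5:]"

definition q1 where "q1 z w = a5 * z ^ 2 + a3 * z * w + a1 * w ^ 2"
definition q2 where "q2 z w = a4 * z ^ 2 + a2 * z * w + a0 * w ^ 2"

definition F where "F = sparse_form [(1, mono4 2 0 0 1), (1, mono4 0 2 1 0),
  (a5, mono4 1 0 2 0), (a3, mono4 1 0 1 1), (a1, mono4 1 0 0 2),
  (a4, mono4 0 1 2 0), (a2, mono4 0 1 1 1), (a0, mono4 0 1 0 2)]"

text \<open>These simplification rules turn subtraction in k into addition and cancel equal
  summands, so that identities in characteristic two follow by normalization. They concern the
  ground field only, not its closure or its polynomials.\<close>

lemma add_self [simp]: "x + x = (0::'a)" "x + (x + y) = (y::'a)"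
  using char2_add_self[OF char2] by (simp_all flip: add.assoc)

lemma minus_eq [simp]: "- x = (x::'a)"
  using char2_neg[OF char2] .

lemma diff_eq [simp]: "x - y = x + (y::'a)"
  using char2_diff[OF char2] .

lemma add_eq_0_iff [simp]: "x + y = 0 \<longleftrightarrow> x = (y::'a)"
  using char2_add_eq_0_iff[OF char2] .

lemma two [simp]: "(2::'a) = 0" by (fact char2)

lemma square_factor_const:
  assumes "h = g ^ 2 * m"
  shows "degree g = 0"
proof -
  have "g dvd 1" using squarefreeD[OF squarefree, of g] assms unfolding h_def by simp
  then show ?thesis by (cases "g = 0") (simp_all add: is_unit_iff_degree)
qed

lemma sqrt: obtains y :: 'a where "y ^ 2 = x"
  using char2_sqrt[OF char2] by blast

lemma square_quadratic: "[:s0, s1, s2:] ^ 2 = [:s0 ^ 2, 0, s1 ^ 2, 0, s2 ^ 2:]" for s0 :: 'a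
  by (simp add: power2_eq_square algebra_simps)

text \<open>If \<open>q1\<close> and \<open>q2\<close> were proportional, \<open>h\<close> would be
  a polynomial of degree at most one times a polynomial in \<open>t^2\<close>. The latter is the
  square of a quadratic polynomial, because its coefficients have square roots in k.\<close>

lemma not_proportional:
  assumes "b * a5 = c * a4" "b * a3 = c * a2" "b * a1 = c * a0"
  shows "b = 0 \<and> c = 0"
proof (rule ccontr)
  assume ne: "\<not> ?thesis"
  show False
  proof (cases "b = 0")
    case True
    with ne assms have 0: "a4 = 0" "a2 = 0" "a0 = 0" by auto
    obtain s0 s1 s2 where s: "s0 ^ 2 = a1" "s1 ^ 2 = a3" "s2 ^ 2 = a5" using sqrt by metis
    have "h = [:s0, s1, s2:] ^ 2 * [:0, 1:]"
      unfolding square_quadratic h_def by (simp add: 0 s)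
    then have "degree [:s0, s1, s2:] = 0" by (rule square_factor_const)
    moreover have "s2 \<noteq> 0" using s lead 0 by auto
    ultimately show False by simp
  next
    case False
    define r where "r = c / b"
    have r: "a5 = r * a4" "a3 = r * a2" "a1 = r * a0"
      using assms False by (simp_all add: r_def field_simps)
    obtain s0 s1 s2 where s: "s0 ^ 2 = a0" "s1 ^ 2 = a2" "s2 ^ 2 = a4" using sqrt by metis
    have "h = [:s0, s1, s2:] ^ 2 * [:1, r:]"
      unfolding square_quadratic h_def by (simp add: r s algebra_simps)
    then have "degree [:s0, s1, s2:] = 0" by (rule square_factor_const)
    moreover have "s2 \<noteq> 0" using s lead r by auto
    ultimately show False by simp
  qed
qed

text \<open>Squarefreeness is known only over k, so a common zero \<theta> over the closure has to
  be brought down. If \<theta> is rational with square root \<tau>, then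
  \<open>(t + \<tau>)^2\<close> divides \<open>h\<close>; otherwise eliminating
  \<open>\<theta>^2\<close> shows that \<open>q1\<close> and \<open>q2\<close> are
  proportional.\<close>

lemma no_common_zero_ac:
  fixes z w :: "'a alg_closure"
  assumes 1: "to_ac a5 * z ^ 2 + to_ac a3 * z * w + to_ac a1 * w ^ 2 = 0"
    and 2: "to_ac a4 * z ^ 2 + to_ac a2 * z * w + to_ac a0 * w ^ 2 = 0"
  shows "z = 0 \<and> w = 0"
proof (cases "w = 0")
  case True
  then show ?thesis using 1 2 lead by auto
next
  case False
  define \<theta> where "\<theta> = z / w"
  have z: "z = \<theta> * w" using False by (simp add: \<theta>_def)
  have "(to_ac a5 * \<theta> ^ 2 + to_ac a3 * \<theta> + to_ac a1) * w ^ 2 = 0"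
    "(to_ac a4 * \<theta> ^ 2 + to_ac a2 * \<theta> + to_ac a0) * w ^ 2 = 0"
    using 1 2 unfolding z by (simp_all add: algebra_simps power2_eq_square)
  then have \<theta>: "to_ac a5 * \<theta> ^ 2 + to_ac a3 * \<theta> + to_ac a1 = 0"
    "to_ac a4 * \<theta> ^ 2 + to_ac a2 * \<theta> + to_ac a0 = 0"
    using False by auto
  have False
  proof (cases "\<theta> \<in> range to_ac")
    case True
    then obtain t where t: "\<theta> = to_ac t" by blast
    have "to_ac (a5 * t ^ 2 + a3 * t + a1) = 0" "to_ac (a4 * t ^ 2 + a2 * t + a0) = 0"
      using \<theta> by (simp_all add: t)
    then have t12: "a1 = t * (a3 + a5 * t)" "a0 = t * (a2 + a4 * t)"
      unfolding to_ac_eq_0_iff by (simp_all add: algebra_simps power2_eq_square)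
    obtain \<tau> where \<tau>: "\<tau> ^ 2 = t" by (rule sqrt)
    have "[:\<tau>, 1:] ^ 2 = [:t, 0, 1:]" by (simp add: power2_eq_square flip: \<tau>)
    then have "h = [:\<tau>, 1:] ^ 2 * [:a2 + a4 * t, a3 + a5 * t, a4, a5:]"
      unfolding h_def by (simp add: t12 algebra_simps)
    then show False using square_factor_const by fastforce
  next
    case False
    \<comment> \<open>A linear equation over k for an irrational \<theta> must be trivial, which is
      the proportionality of the coefficient vectors.\<close>
    have "to_ac (a5 * a2 - a4 * a3) * \<theta> + to_ac (a5 * a0 - a4 * a1) =
       to_ac a5 * (to_ac a4 * \<theta> ^ 2 + to_ac a2 * \<theta> + to_ac a0) -
       to_ac a4 * (to_ac a5 * \<theta> ^ 2 + to_ac a3 * \<theta> + to_ac a1)"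
      by (simp add: algebra_simps del: diff_eq)
    then have lin: "to_ac (a5 * a2 - a4 * a3) * \<theta> + to_ac (a5 * a0 - a4 * a1) = 0"
      by (simp only: \<theta>) simp
    define u v where "u = a5 * a2 - a4 * a3" and "v = a5 * a0 - a4 * a1"
    have lin: "to_ac u * \<theta> + to_ac v = 0" using lin by (simp only: u_def v_def)
    have "u = 0"
    proof (rule ccontr)
      assume "u \<noteq> 0"
      then have "to_ac u * (\<theta> + to_ac (v / u)) = 0" using lin by (simp add: distrib_left)
      with \<open>u \<noteq> 0\<close> have "\<theta> = to_ac (- (v / u))" by (simp only: mult_eq_0_iff to_ac_eq_0_iff to_ac_minus eq_neg_iff_add_eq_0) simp
      then show False using False by blast
    qed
    with lin have "v = 0" by simp
    with \<open>u = 0\<close> show False using not_proportional[of a4 a5] lead by (auto simp: u_def v_def mult.commute)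
  qed
  then show ?thesis ..
qed

lemma no_common_zero:
  assumes "q1 z w = 0" "q2 z w = 0"
  shows "z = 0 \<and> w = 0"
proof -
  have "to_ac (q1 z w) = 0" "to_ac (q2 z w) = 0" using assms by simp_all
  then show ?thesis using no_common_zero_ac[of "to_ac z" "to_ac w"] by (simp add: q1_def q2_def)
qed

lemma eval_F:
  "eval_cubic id F v = v $ 1 ^ 2 * v $ 4 + v $ 2 ^ 2 * v $ 3 + v $ 1 * q1 (v $ 3) (v $ 4) + v $ 2 * q2 (v $ 3) (v $ 4)"
  by (simp add: F_def q1_def q2_def eval_sparse_simps algebra_simps)

text \<open>The partial derivatives in x and y are \<open>q1\<close> and \<open>q2\<close>, so a
  singular point has z = w = 0; there the other two are \<open>y^2\<close> and
  \<open>x^2\<close>.\<close>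

lemma smooth: "smooth_cubic F"
proof -
  note two = char2_alg_closure[OF char2]
  have "x = 0" if "\<forall>j. eval_partial to_ac F j x = 0" for x :: "'a alg_closure ^ 4"
  proof -
    from that have
      "to_ac a5 * x $ 3 ^ 2 + to_ac a3 * x $ 3 * x $ 4 + to_ac a1 * x $ 4 ^ 2 = 0"
      "to_ac a4 * x $ 3 ^ 2 + to_ac a2 * x $ 3 * x $ 4 + to_ac a0 * x $ 4 ^ 2 = 0"
      and *: "x $ 3 = 0 \<and> x $ 4 = 0 \<longrightarrow> x $ 1 = 0 \<and> x $ 2 = 0"
      by (auto simp: F_def eval_sparse_simps forall_4 two algebra_simps)
    from no_common_zero_ac[OF this(1,2)] * show ?thesis by (simp add: vec4_eq_iff)
  qed
  moreover have "F (mono4 2 0 0 1) \<noteq> 0" by (simp add: F_def)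
  ultimately show ?thesis unfolding smooth_cubic_def by fastforce
qed

subsection \<open>Classification of the lines\<close>

fun graph1 where "graph1 (\<alpha>, \<beta>, \<gamma>, \<delta>) = span2 (vec4 1 0 \<alpha> \<gamma>) (vec4 0 1 \<beta> \<delta> :: 'a ^ 4)"
fun graph2 where "graph2 (\<alpha>, \<beta>, \<gamma>, \<delta>) = span2 (vec4 \<alpha> \<gamma> 1 0) (vec4 \<beta> \<delta> 0 1 :: 'a ^ 4)"
text \<open>On the join of (a:b:0:0) and (0:0:c:d) the terms \<open>x^2 w + y^2 z\<close> force
  (c:d) = (a^2:b^2), which is why one parameter determines the line.\<close>

fun transversal where "transversal (a, b) = span2 (vec4 a b 0 0) (vec4 0 0 (a ^ 2) (b ^ 2) :: 'a ^ 4)"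

lemma mem_graph1:
  "v \<in> graph1 (\<alpha>, \<beta>, \<gamma>, \<delta>) \<longleftrightarrow> v $ 3 = \<alpha> * v $ 1 + \<beta> * v $ 2 \<and> v $ 4 = \<gamma> * v $ 1 + \<delta> * v $ 2"
  by (auto simp: span2_def vec4_eq_iff mult.commute)

lemma mem_graph2:
  "v \<in> graph2 (\<alpha>, \<beta>, \<gamma>, \<delta>) \<longleftrightarrow> v $ 1 = \<alpha> * v $ 3 + \<beta> * v $ 4 \<and> v $ 2 = \<gamma> * v $ 3 + \<delta> * v $ 4"
  by (auto simp: span2_def vec4_eq_iff mult.commute)

lemma mem_transversal:
  "v \<in> transversal (a, b) \<longleftrightarrow> (\<exists>s t. v = vec4 (s * a) (s * b) (t * a ^ 2) (t * b ^ 2))"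
  by (auto simp: span2_def vec4_eq_iff)

text \<open>The coefficients of the restriction of \<open>F\<close> to \<open>graph1\<close> and \<open>graph2\<close>. The condition
  $\<alpha> \<delta> = \<beta> \<gamma>$ in \<open>eqs2\<close> selects the lines meeting $x = y = 0$; the others are of the form \<open>graph1\<close>.\<close>
definition eqs1 where
  "eqs1 = {(\<alpha>, \<beta>, \<gamma>, \<delta>). \<gamma> = q1 \<alpha> \<gamma> \<and> \<beta> = q2 \<beta> \<delta> \<and>
     \<delta> = a3 * (\<alpha> * \<delta> + \<beta> * \<gamma>) + q2 \<alpha> \<gamma> \<and> \<alpha> = a2 * (\<alpha> * \<delta> + \<beta> * \<gamma>) + q1 \<beta> \<delta>}"

definition eqs2 where
  "eqs2 = {(\<alpha>, \<beta>, \<gamma>, \<delta>). \<alpha> * \<delta> = \<beta> * \<gamma> \<and>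
     \<gamma> ^ 2 = a5 * \<alpha> + a4 * \<gamma> \<and> \<alpha> ^ 2 = a3 * \<alpha> + a5 * \<beta> + a2 * \<gamma> + a4 * \<delta> \<and>
     \<delta> ^ 2 = a1 * \<alpha> + a3 * \<beta> + a0 * \<gamma> + a2 * \<delta> \<and> \<beta> ^ 2 = a1 * \<beta> + a0 * \<delta>}"

definition roots :: "('a \<times> 'a) set" where
  "roots = {(\<tau>, 1) |\<tau>. poly h \<tau> = 0} \<union> (if a5 = 0 then {(1, 0)} else {})"

lemma eval_F_graph1:
  "eval_cubic id F (s *s vec4 1 0 \<alpha> \<gamma> + t *s vec4 0 1 \<beta> \<delta>) =
     (\<gamma> + q1 \<alpha> \<gamma>) * s ^ 3 + (\<delta> + (a3 * (\<alpha> * \<delta> + \<beta> * \<gamma>) + q2 \<alpha> \<gamma>)) * s ^ 2 * t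
     + (\<alpha> + (a2 * (\<alpha> * \<delta> + \<beta> * \<gamma>) + q1 \<beta> \<delta>)) * s * t ^ 2 + (\<beta> + q2 \<beta> \<delta>) * t ^ 3"
  by (simp add: eval_F q1_def q2_def algebra_simps power_numeral_reduce)

lemma eval_F_graph2:
  "eval_cubic id F (s *s vec4 \<alpha> \<gamma> 1 0 + t *s vec4 \<beta> \<delta> 0 1) =
     (\<gamma> ^ 2 + (a5 * \<alpha> + a4 * \<gamma>)) * s ^ 3 + (\<alpha> ^ 2 + (a3 * \<alpha> + a5 * \<beta> + a2 * \<gamma> + a4 * \<delta>)) * s ^ 2 * t
     + (\<delta> ^ 2 + (a1 * \<alpha> + a3 * \<beta> + a0 * \<gamma> + a2 * \<delta>)) * s * t ^ 2 + (\<beta> ^ 2 + (a1 * \<beta> + a0 * \<delta>)) * t ^ 3"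
  by (simp add: eval_F q1_def q2_def algebra_simps power_numeral_reduce)

text \<open>The zero terms keep the shape expected by \<open>cubic_vanishes\<close>.\<close>

lemma eval_F_join:
  "eval_cubic id F (s *s vec4 a b 0 0 + t *s vec4 0 0 c d) =
     0 * s ^ 3 + (a ^ 2 * d + b ^ 2 * c) * s ^ 2 * t + (a * q1 c d + b * q2 c d) * s * t ^ 2 + 0 * t ^ 3"
  by (simp add: eval_F q1_def q2_def algebra_simps power_numeral_reduce)

lemma lin_indep_graph:
  "lin_indep2 (vec4 1 0 \<alpha> \<gamma>) (vec4 0 1 \<beta> \<delta> :: 'a ^ 4)"
  "lin_indep2 (vec4 \<alpha> \<gamma> 1 0) (vec4 \<beta> \<delta> 0 1 :: 'a ^ 4)"
  by (auto simp: lin_indep2_def vec4_eq_iff)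

lemma poly_h: "poly h \<tau> = \<tau> * q1 (\<tau> ^ 2) 1 + q2 (\<tau> ^ 2) 1"
  by (simp add: h_def q1_def q2_def algebra_simps power_numeral_reduce)

lemma graph1_in_k_lines: "M \<in> eqs1 \<Longrightarrow> graph1 M \<in> k_lines F"
  by (cases M) (auto simp: eqs1_def eval_F_graph1 simp del: add_eq_0_iff intro!: k_linesI[OF card] lin_indep_graph)

lemma graph2_in_k_lines: "M \<in> eqs2 \<Longrightarrow> graph2 M \<in> k_lines F"
  by (cases M) (auto simp: eqs2_def eval_F_graph2 simp del: add_eq_0_iff intro!: k_linesI[OF card] lin_indep_graph)

lemma transversal_in_k_lines:
  assumes "r \<in> roots"
  shows "transversal r \<in> k_lines F"
proof -
  obtain a b where r: "r = (a, b)" by force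
  have "a * q1 (a ^ 2) (b ^ 2) + b * q2 (a ^ 2) (b ^ 2) = 0" and "a \<noteq> 0 \<or> b \<noteq> 0"
    using assms by (auto simp: roots_def r poly_h q1_def split: if_splits)
  moreover from this have "lin_indep2 (vec4 a b 0 0) (vec4 0 0 (a ^ 2) (b ^ 2))"
    by (auto simp: lin_indep2_def vec4_eq_iff)
  ultimately show ?thesis
    unfolding r transversal.simps by (intro k_linesI[OF card]) (simp_all only: eval_F_join, simp)
qed

text \<open>The cases are: missing x = y = 0, meeting it but missing z = w = 0, and meeting both. A
  line that misses one of the skew lines is a graph over the corresponding pair of
  coordinates.\<close>

lemma k_lines_cases:
  assumes "l \<in> k_lines F"
  shows "l \<in> graph1 ` eqs1 \<union> graph2 ` eqs2 \<union> transversal ` roots"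
proof -
  obtain p q where l: "l = span2 p q" and ind: "lin_indep2 p q"
    and 0: "\<And>v. v \<in> span2 p q \<Longrightarrow> eval_cubic id F v = 0"
    using assms unfolding k_lines_eq[OF card] by blast
  have comb: "eval_cubic id F (s *s u + t *s v) = 0" if "u \<in> l" "v \<in> l" for s t u v
    using that unfolding l by (intro 0 span2_comb)
  consider (graph1) "\<And>a b. \<exists>v\<in>l. v $ 1 = a \<and> v $ 2 = b"
    | (graph2) v where "\<And>a b. \<exists>v\<in>l. v $ 3 = a \<and> v $ 4 = b" "v \<in> l" "v \<noteq> 0" "v $ 1 = 0" "v $ 2 = 0"
    | (join) u v where "u \<in> l" "u \<noteq> 0" "u $ 3 = 0" "u $ 4 = 0" "v \<in> l" "v \<noteq> 0" "v $ 1 = 0" "v $ 2 = 0"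
    using span2_coords_dichotomy[OF ind, of 1 2] span2_coords_dichotomy[OF ind, of 3 4]
    unfolding l by blast
  then show ?thesis
  proof cases
    case graph1
    obtain u v where uv: "u \<in> l" "u $ 1 = 1" "u $ 2 = 0" "v \<in> l" "v $ 1 = 0" "v $ 2 = 1"
      using graph1[of 1 0] graph1[of 0 1] by blast
    then obtain \<alpha> \<beta> \<gamma> \<delta> where eq: "u = vec4 1 0 \<alpha> \<gamma>" "v = vec4 0 1 \<beta> \<delta>"
      by (simp add: vec4_eq_iff)
    have "l = graph1 (\<alpha>, \<beta>, \<gamma>, \<delta>)"
      unfolding l graph1.simps using uv lin_indep_graph(1) unfolding eq l
      by (intro span2_eqI[symmetric]) auto
    moreover have "(\<alpha>, \<beta>, \<gamma>, \<delta>) \<in> eqs1"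
      using cubic_vanishes[OF card, OF comb[OF uv(1,4), unfolded eq eval_F_graph1]]
      by (simp add: eqs1_def)
    ultimately show ?thesis by blast
  next
    case (graph2 v0)
    obtain u v where uv: "u \<in> l" "u $ 3 = 1" "u $ 4 = 0" "v \<in> l" "v $ 3 = 0" "v $ 4 = 1"
      using graph2(1)[of 1 0] graph2(1)[of 0 1] by blast
    then obtain \<alpha> \<beta> \<gamma> \<delta> where eq: "u = vec4 \<alpha> \<gamma> 1 0" "v = vec4 \<beta> \<delta> 0 1"
      by (simp add: vec4_eq_iff)
    have l2: "l = graph2 (\<alpha>, \<beta>, \<gamma>, \<delta>)"
      unfolding l graph2.simps using uv lin_indep_graph(2) unfolding eq l
      by (intro span2_eqI[symmetric]) auto
    \<comment> \<open>The point \<open>v0\<close> on x = y = 0 gives a nonzero kernel vector of the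
      matrix, so its determinant vanishes.\<close>
    have "\<alpha> * v0 $ 3 = \<beta> * v0 $ 4" "\<gamma> * v0 $ 3 = \<delta> * v0 $ 4"
      and "v0 $ 3 \<noteq> 0 \<or> v0 $ 4 \<noteq> 0"
      using graph2(2-5) unfolding l2 mem_graph2 by (auto simp: vec4_eq_iff)
    moreover have "v0 $ 3 * (\<alpha> * \<delta>) = v0 $ 3 * (\<beta> * \<gamma>)" if z: "\<alpha> * v0 $ 3 = \<beta> * v0 $ 4" "\<gamma> * v0 $ 3 = \<delta> * v0 $ 4"
    proof -
      have "v0 $ 3 * (\<alpha> * \<delta>) = (\<alpha> * v0 $ 3) * \<delta>" by (simp only: mult_ac)
      also have "\<dots> = \<beta> * (\<delta> * v0 $ 4)" by (simp only: z(1) mult_ac)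
      finally show ?thesis by (simp only: z(2)[symmetric] mult_ac)
    qed
    moreover have "v0 $ 4 * (\<alpha> * \<delta>) = v0 $ 4 * (\<beta> * \<gamma>)" if z: "\<alpha> * v0 $ 3 = \<beta> * v0 $ 4" "\<gamma> * v0 $ 3 = \<delta> * v0 $ 4"
    proof -
      have "v0 $ 4 * (\<alpha> * \<delta>) = (\<delta> * v0 $ 4) * \<alpha>" by (simp only: mult_ac)
      also have "\<dots> = \<gamma> * (\<alpha> * v0 $ 3)" by (simp only: z(2)[symmetric] mult_ac)
      finally show ?thesis by (simp only: z(1) mult_ac)
    qed
    ultimately have "\<alpha> * \<delta> = \<beta> * \<gamma>" by auto
    moreover note cubic_vanishes[OF card, OF comb[OF uv(1,4), unfolded eq eval_F_graph2]]
    ultimately have "(\<alpha>, \<beta>, \<gamma>, \<delta>) \<in> eqs2" by (simp add: eqs2_def)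
    with l2 show ?thesis by blast
  next
    case (join u v)
    define a b c d where "a = u $ 1" and "b = u $ 2" and "c = v $ 3" and "d = v $ 4"
    have eq: "u = vec4 a b 0 0" "v = vec4 0 0 c d"
      using join by (simp_all add: vec4_eq_iff a_def b_def c_def d_def)
    have ne: "a \<noteq> 0 \<or> b \<noteq> 0" "c \<noteq> 0 \<or> d \<noteq> 0"
      using join(2,6) unfolding eq by (auto simp: vec4_eq_iff)
    have R: "a ^ 2 * d = b ^ 2 * c" and P: "a * q1 c d = b * q2 c d"
      using cubic_vanishes[OF card, OF comb[OF join(1,5), unfolded eq eval_F_join]] by simp_all
    have trans: "l = transversal (x, y)"
      if "a = k * x" "b = k * y" "c = m * x ^ 2" "d = m * y ^ 2" for x y k m
    proof -
      have km: "k \<noteq> 0" "m \<noteq> 0" and xy: "x \<noteq> 0 \<or> y \<noteq> 0" using ne that by auto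
      have "(1 / k) *s u = vec4 x y 0 0" "(1 / m) *s v = vec4 0 0 (x ^ 2) (y ^ 2)"
        using km by (simp_all add: eq that vec4_eq_iff)
      then have "vec4 x y 0 0 \<in> l" "vec4 0 0 (x ^ 2) (y ^ 2) \<in> l"
        using span2_scale join(1,5) unfolding l by metis+
      moreover have "lin_indep2 (vec4 x y 0 0) (vec4 0 0 (x ^ 2) (y ^ 2))"
        using xy by (auto simp: lin_indep2_def vec4_eq_iff)
      ultimately show ?thesis unfolding l transversal.simps by (intro span2_eqI[symmetric])
    qed
    show ?thesis
    proof (cases "b = 0")
      case True
      then have "a \<noteq> 0" "d = 0" using ne R by auto
      then have "a5 = 0" using P True ne by (auto simp: q1_def)
      then have "(1, 0) \<in> roots" unfolding roots_def by simp
      moreover have "l = transversal (1, 0)"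
        using trans[of a 1 0 c] True \<open>d = 0\<close> by simp
      ultimately show ?thesis by blast
    next
      case False
      define \<tau> where "\<tau> = a / b"
      have a: "a = b * \<tau>" using False by (simp add: \<tau>_def)
      have "b ^ 2 * (d * \<tau> ^ 2) = b ^ 2 * c" using R by (simp add: a power_mult_distrib mult_ac)
      then have c: "c = d * \<tau> ^ 2" using False by auto
      then have "d \<noteq> 0" using ne by auto
      have "(b * d ^ 2) * poly h \<tau> = a * q1 c d + b * q2 c d"
        unfolding poly_h a c by (simp add: q1_def q2_def algebra_simps power_numeral_reduce)
      then have "poly h \<tau> = 0" using P False \<open>d \<noteq> 0\<close> by simp
      then have "(\<tau>, 1) \<in> roots" unfolding roots_def by blast
      moreover have "l = transversal (\<tau>, 1)"
        using trans[of b \<tau> 1 d] a c by simp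
      ultimately show ?thesis by blast
    qed
  qed
qed

lemma k_lines_F: "k_lines F = graph1 ` eqs1 \<union> graph2 ` eqs2 \<union> transversal ` roots"
  using k_lines_cases graph1_in_k_lines graph2_in_k_lines transversal_in_k_lines by blast

section \<open>Distinctness of the listed lines\<close>

lemma inj_graph1: "inj graph1"
proof (rule injI)
  fix M M' assume eq: "graph1 M = graph1 M'"
  obtain \<alpha> \<beta> \<gamma> \<delta> where M: "M = (\<alpha>, \<beta>, \<gamma>, \<delta>)" by (metis prod_cases4)
  obtain \<alpha>' \<beta>' \<gamma>' \<delta>' where M': "M' = (\<alpha>', \<beta>', \<gamma>', \<delta>')" by (metis prod_cases4)
  have "vec4 1 0 \<alpha> \<gamma> \<in> graph1 M'" "vec4 0 1 \<beta> \<delta> \<in> graph1 M'"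
    unfolding eq[symmetric] M by (simp_all add: mem_graph1 del: graph1.simps)
  then show "M = M'" by (simp add: M M' mem_graph1 del: graph1.simps)
qed

lemma inj_graph2: "inj graph2"
proof (rule injI)
  fix M M' assume eq: "graph2 M = graph2 M'"
  obtain \<alpha> \<beta> \<gamma> \<delta> where M: "M = (\<alpha>, \<beta>, \<gamma>, \<delta>)" by (metis prod_cases4)
  obtain \<alpha>' \<beta>' \<gamma>' \<delta>' where M': "M' = (\<alpha>', \<beta>', \<gamma>', \<delta>')" by (metis prod_cases4)
  have "vec4 \<alpha> \<gamma> 1 0 \<in> graph2 M'" "vec4 \<beta> \<delta> 0 1 \<in> graph2 M'"
    unfolding eq[symmetric] M by (simp_all add: mem_graph2 del: graph2.simps)
  then show "M = M'" by (simp add: M M' mem_graph2 del: graph2.simps)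
qed

lemma inj_on_transversal: "inj_on transversal roots"
proof (rule inj_onI)
  fix r r' assume r: "r \<in> roots" and r': "r' \<in> roots" and eq: "transversal r = transversal r'"
  obtain a b where ab: "r = (a, b)" by force
  obtain a' b' where ab': "r' = (a', b')" by force
  have "vec4 a b 0 0 \<in> transversal r'"
    unfolding eq[symmetric] ab transversal.simps by (rule span2_generators)
  then show "r = r'"
    using r r' unfolding ab ab' mem_transversal
    by (auto simp: roots_def vec4_eq_iff split: if_splits)
qed

text \<open>The three families are told apart by the skew lines they meet: \<open>graph1\<close>
  never meets x = y = 0, \<open>graph2\<close> never meets z = w = 0 but for solutions of
  \<open>eqs2\<close> meets x = y = 0, and transversals meet both.\<close>

lemma card_k_lines: "card (k_lines F) = card eqs1 + card eqs2 + card roots"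
proof -
  have 1: "v = 0" if "v \<in> graph1 M" "v $ 1 = 0" "v $ 2 = 0" for v M
    using that by (cases M) (simp add: mem_graph1 vec4_eq_iff del: graph1.simps)
  have 2: "v = 0" if "v \<in> graph2 M" "v $ 3 = 0" "v $ 4 = 0" for v M
    using that by (cases M) (simp add: mem_graph2 vec4_eq_iff del: graph2.simps)
  have 3: "\<exists>v\<in>graph2 M. v \<noteq> 0 \<and> v $ 1 = 0 \<and> v $ 2 = 0" if M: "M \<in> eqs2" for M
  proof -
    obtain \<alpha> \<beta> \<gamma> \<delta> where M': "M = (\<alpha>, \<beta>, \<gamma>, \<delta>)" by (metis prod_cases4)
    have "\<alpha> * \<delta> = \<beta> * \<gamma>" using M by (simp add: M' eqs2_def)
    \<comment> \<open>Kernel vectors of a singular matrix, read off from its rows; the zero matrix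
      needs its own witness.\<close>
    then have "vec4 0 0 \<beta> \<alpha> \<in> graph2 M" "vec4 0 0 \<delta> \<gamma> \<in> graph2 M" "\<alpha> = 0 \<and> \<beta> = 0 \<and> \<gamma> = 0 \<and> \<delta> = 0 \<Longrightarrow> vec4 0 0 1 0 \<in> graph2 M"
      by (simp_all add: M' mem_graph2 mult.commute del: graph2.simps)
    moreover have "vec4 0 0 \<beta> \<alpha> \<noteq> 0 \<or> vec4 0 0 \<delta> \<gamma> \<noteq> 0 \<or> \<alpha> = 0 \<and> \<beta> = 0 \<and> \<gamma> = 0 \<and> \<delta> = 0"
      "vec4 0 0 1 0 \<noteq> (0 :: 'a ^ 4)"
      by (auto simp: vec4_eq_iff)
    ultimately show ?thesis by (metis vec4_nth(1,2))
  qed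
  have 4: "\<exists>v\<in>transversal r. v \<noteq> 0 \<and> v $ 1 = 0 \<and> v $ 2 = 0" "\<exists>v\<in>transversal r. v \<noteq> 0 \<and> v $ 3 = 0 \<and> v $ 4 = 0"
    if r: "r \<in> roots" for r
  proof -
    obtain a b where ab: "r = (a, b)" by force
    have "a \<noteq> 0 \<or> b \<noteq> 0" using r by (auto simp: roots_def ab split: if_splits)
    then have "vec4 0 0 (a ^ 2) (b ^ 2) \<noteq> 0" "vec4 a b 0 0 \<noteq> 0" by (auto simp: vec4_eq_iff)
    moreover have "vec4 a b 0 0 \<in> transversal r" "vec4 0 0 (a ^ 2) (b ^ 2) \<in> transversal r"
      unfolding ab transversal.simps by (rule span2_generators)+
    ultimately show "\<exists>v\<in>transversal r. v \<noteq> 0 \<and> v $ 1 = 0 \<and> v $ 2 = 0"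
      "\<exists>v\<in>transversal r. v \<noteq> 0 \<and> v $ 3 = 0 \<and> v $ 4 = 0" by force+
  qed
  have fin: "finite eqs1" "finite eqs2" "finite roots" by (rule finite)+
  have "graph1 ` eqs1 \<inter> graph2 ` eqs2 = {}"
  proof -
    have "graph1 M \<noteq> graph2 M'" if "M' \<in> eqs2" for M M'
      using 3[OF that] 1[of _ M] by (metis (no_types, lifting))
    then show ?thesis by (simp add: disjoint_iff image_iff) metis
  qed
  moreover have "(graph1 ` eqs1 \<union> graph2 ` eqs2) \<inter> transversal ` roots = {}"
  proof -
    have "graph1 M \<noteq> transversal r" "graph2 M \<noteq> transversal r" if "r \<in> roots" for M r
      using 4[OF that] 1[of _ M] 2[of _ M] by (metis (no_types, lifting))+
    then show ?thesis by (simp add: disjoint_iff image_iff) metis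
  qed
  ultimately have "card (k_lines F) = card (graph1 ` eqs1) + card (graph2 ` eqs2) + card (transversal ` roots)"
    unfolding k_lines_F using fin by (simp add: card_Un_disjoint)
  then show ?thesis
    using inj_graph1 inj_graph2 inj_on_transversal by (simp add: card_image inj_on_subset[OF _ subset_UNIV])
qed

text \<open>For a root $(a : b)$ of the quintic, the plane through $z = w = 0$ that contains the transversal
  at $(a : b)$ contains one more line, \<open>root_solution1\<close>; \<open>root_solution2\<close> is the analogue for
  $x = y = 0$.\<close>
definition root_solution1 :: "'a \<times> 'a \<Rightarrow> 'a \<times> 'a \<times> 'a \<times> 'a" where
  "root_solution1 r = (let (a, b) = r; e = (if b = 0 then a4 else q1 (a ^ 2) 1) in
     (a ^ 2 * b / e, a ^ 3 / e, b / e, a * b / e))"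

definition root_solution2 :: "'a \<times> 'a \<Rightarrow> 'a \<times> 'a \<times> 'a \<times> 'a" where
  "root_solution2 r = (let (a, b) = r; (m1, m0) = (if b = 0 then (a3, a1) else
      (a5 * a + a4, a3 * a + a2 + a ^ 2 * (a5 * a + a4))) in (a * m1, a * m0, b * m1, b * m0))"

lemma root_solution1_simps:
  "root_solution1 (\<tau>, 1) = (\<tau> ^ 2 / q1 (\<tau> ^ 2) 1, \<tau> ^ 3 / q1 (\<tau> ^ 2) 1, 1 / q1 (\<tau> ^ 2) 1, \<tau> / q1 (\<tau> ^ 2) 1)"
  "root_solution1 (1, 0) = (0, 1 / a4, 0, 0)"
  by (simp_all add: root_solution1_def Let_def)

lemma infinity_in_roots: "a5 = 0 \<Longrightarrow> (1, 0) \<in> roots"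
  unfolding roots_def by simp

lemma roots_cases [consumes 1, case_names affine infinity]:
  assumes "r \<in> roots"
  obtains \<tau> where "poly h \<tau> = 0" "r = (\<tau>, 1)" | "a5 = 0" "r = (1, 0)"
  using assms unfolding roots_def by (auto split: if_splits)

text \<open>In characteristic two \<open>q1 (\<tau> ^ 2) 1\<close> is the derivative of
  \<open>h\<close> at \<tau>, and roots are simple.\<close>

lemma root_derivative_nonzero: "poly h \<tau> = 0 \<Longrightarrow> q1 (\<tau> ^ 2) 1 \<noteq> 0"
  using no_common_zero[of "\<tau> ^ 2" 1] by (auto simp: poly_h)

text \<open>In the plane \<open>z = \<tau>^2 w\<close> of a root, with
  \<open>e = h'(\<tau>)\<close>, the cubic form is
  \<open>w (x + \<tau> y) (x + \<tau> y + e w)\<close>, and the last factor is the line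
  \<open>root_solution1\<close>. At infinity the plane is w = 0 and the form is
  \<open>y z (y + a4 z)\<close>. The zero matrix is the line z = w = 0 itself.\<close>

lemma singular_eqs1:
  "{(\<alpha>, \<beta>, \<gamma>, \<delta>) \<in> eqs1. \<alpha> * \<delta> = \<beta> * \<gamma>} = insert (0, 0, 0, 0) (root_solution1 ` roots)" (is "?A = ?B")
proof
  show "?A \<subseteq> ?B"
  proof (rule subsetI, rule ccontr)
    fix M assume M': "M \<in> ?A" and "M \<notin> ?B"
    moreover obtain \<alpha> \<beta> \<gamma> \<delta> where "M = (\<alpha>, \<beta>, \<gamma>, \<delta>)" by (metis prod_cases4)
    ultimately have M: "(\<alpha>, \<beta>, \<gamma>, \<delta>) \<in> eqs1" "\<alpha> * \<delta> = \<beta> * \<gamma>"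
      and nim: "(\<alpha>, \<beta>, \<gamma>, \<delta>) \<notin> root_solution1 ` roots"
      and nz: "\<not> (\<alpha> = 0 \<and> \<beta> = 0 \<and> \<gamma> = 0 \<and> \<delta> = 0)"
      by auto
    have D: "\<alpha> * \<delta> + \<beta> * \<gamma> = 0" using M(2) by simp
    from M(1) have E: "q1 \<alpha> \<gamma> = \<gamma>" "q2 \<beta> \<delta> = \<beta>" "q2 \<alpha> \<gamma> = \<delta>" "q1 \<beta> \<delta> = \<alpha>"
      unfolding eqs1_def mem_Collect_eq prod.case D mult_zero_right add_0_left by metis+
    have "\<gamma> = 0"
    proof (rule ccontr)
      assume \<gamma>: "\<gamma> \<noteq> 0"
      define \<tau> where "\<tau> = \<delta> / \<gamma>"
      have \<delta>: "\<delta> = \<gamma> * \<tau>" using \<gamma> by (simp add: \<tau>_def)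
      have \<beta>: "\<beta> = \<alpha> * \<tau>" using M(2) \<gamma> by (simp add: \<tau>_def field_simps)
      \<comment> \<open>The second column is \<tau> times the first, so homogeneity of degree two
        pins down the ratio of \<alpha> to \<gamma>.\<close>
      have "q1 \<beta> \<delta> = q1 \<alpha> \<gamma> * \<tau> ^ 2"
        unfolding \<beta> \<delta> by (simp add: q1_def algebra_simps power_numeral_reduce)
      then have \<alpha>: "\<alpha> = \<gamma> * \<tau> ^ 2" by (simp only: E)
      have Q: "q1 \<alpha> \<gamma> = \<gamma> * (\<gamma> * q1 (\<tau> ^ 2) 1)" "q2 \<alpha> \<gamma> = \<gamma> * (\<gamma> * q2 (\<tau> ^ 2) 1)"
        unfolding \<alpha> by (simp_all add: q1_def q2_def algebra_simps power_numeral_reduce)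
      have "\<gamma> * (\<gamma> * q1 (\<tau> ^ 2) 1) = \<gamma> * 1" "\<gamma> * (\<gamma> * q2 (\<tau> ^ 2) 1) = \<gamma> * \<tau>"
        by (simp_all only: Q[symmetric] E(1,3) mult_1_right \<delta>[symmetric])
      then have 1: "\<gamma> * q1 (\<tau> ^ 2) 1 = 1" and 2: "\<gamma> * q2 (\<tau> ^ 2) 1 = \<tau>"
        using \<gamma> by (simp_all only: mult_cancel_left) simp_all
      have "\<gamma> * poly h \<tau> = \<tau> * (\<gamma> * q1 (\<tau> ^ 2) 1) + \<gamma> * q2 (\<tau> ^ 2) 1"
        by (simp add: poly_h algebra_simps)
      also have "\<dots> = 0" by (simp only: 1 2) simp
      finally have "(\<tau>, 1) \<in> roots" using \<gamma> by (simp add: roots_def)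
      moreover have "\<gamma> = 1 / q1 (\<tau> ^ 2) 1" using 1 by (metis eq_divide_eq mult_zero_right zero_neq_one)
      then have "(\<alpha>, \<beta>, \<gamma>, \<delta>) = root_solution1 (\<tau>, 1)"
        unfolding \<beta> \<alpha> \<delta> by (simp add: root_solution1_simps power2_eq_square power3_eq_cube)
      ultimately show False using nim by blast
    qed
    have "\<alpha> = 0"
    proof (rule ccontr)
      assume "\<alpha> \<noteq> 0"
      with M(2) \<open>\<gamma> = 0\<close> have "\<delta> = 0" by simp
      with E(1,3) \<open>\<gamma> = 0\<close> \<open>\<alpha> \<noteq> 0\<close> lead show False by (simp add: q1_def q2_def)
    qed
    with E \<open>\<gamma> = 0\<close> have "\<delta> = 0" by (simp add: q2_def)
    have "\<beta> = 0"
    proof (rule ccontr)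
      assume "\<beta> \<noteq> 0"
      have Q: "q1 \<beta> \<delta> = \<beta> * (a5 * \<beta>)" "q2 \<beta> \<delta> = \<beta> * (a4 * \<beta>)"
        by (simp_all add: \<open>\<delta> = 0\<close> q1_def q2_def power2_eq_square mult_ac)
      then have "\<beta> * (a5 * \<beta>) = \<beta> * 0" "\<beta> * (a4 * \<beta>) = \<beta> * 1"
        by (simp_all only: Q[symmetric] E \<open>\<alpha> = 0\<close> mult_1_right mult_zero_right)
      with \<open>\<beta> \<noteq> 0\<close> have "a5 = 0" "a4 * \<beta> = 1" by (simp_all only: mult_cancel_left) simp_all
      from \<open>a5 = 0\<close> have "(1, 0) \<in> roots" by (rule infinity_in_roots)
      moreover have "\<beta> = 1 / a4" using \<open>a4 * \<beta> = 1\<close> by (cases "a4 = 0") (simp_all add: field_simps)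
      then have "(\<alpha>, \<beta>, \<gamma>, \<delta>) = root_solution1 (1, 0)"
        using \<open>\<alpha> = 0\<close> \<open>\<gamma> = 0\<close> \<open>\<delta> = 0\<close> by (simp add: root_solution1_simps)
      ultimately show False using nim by blast
    qed
    with \<open>\<alpha> = 0\<close> \<open>\<gamma> = 0\<close> \<open>\<delta> = 0\<close> nz show False by blast
  qed
  show "?B \<subseteq> ?A"
  proof -
    have "root_solution1 (\<tau>, 1) \<in> ?A" if \<tau>: "poly h \<tau> = 0" for \<tau>
    proof -
      define e where "e = q1 (\<tau> ^ 2) 1"
      have e: "e \<noteq> 0" unfolding e_def by (rule root_derivative_nonzero[OF \<tau>])
      have q2: "q2 (\<tau> ^ 2) 1 = \<tau> * e" using \<tau> by (simp add: poly_h e_def)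
      have "q1 (c * \<tau> ^ 2) (c * 1) = c ^ 2 * q1 (\<tau> ^ 2) 1" "q2 (c * \<tau> ^ 2) (c * 1) = c ^ 2 * q2 (\<tau> ^ 2) 1" for c
        by (simp_all add: q1_def q2_def algebra_simps power_numeral_reduce)
      then have hom1: "q1 (c * \<tau> ^ 2) (c * 1) = c ^ 2 * e" and hom2: "q2 (c * \<tau> ^ 2) (c * 1) = c ^ 2 * (\<tau> * e)" for c
        by (simp_all only: q2 e_def)
      have "q1 (\<tau> ^ 2 / e) (1 / e) = 1 / e" "q2 (\<tau> ^ 2 / e) (1 / e) = \<tau> / e"
        "q1 (\<tau> ^ 3 / e) (\<tau> / e) = \<tau> ^ 2 / e" "q2 (\<tau> ^ 3 / e) (\<tau> / e) = \<tau> ^ 3 / e"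
        using hom1[of "1 / e"] hom2[of "1 / e"] hom1[of "\<tau> / e"] hom2[of "\<tau> / e"] e
        by (simp_all add: power_numeral_reduce field_simps)
      then show ?thesis
        using e unfolding root_solution1_simps e_def[symmetric]
        by (simp add: eqs1_def power2_eq_square power3_eq_cube)
    qed
    moreover have "root_solution1 (1, 0) \<in> ?A" if "a5 = 0"
      using that lead unfolding root_solution1_simps eqs1_def q1_def q2_def by (simp add: power2_eq_square)
    moreover have "(0, 0, 0, 0) \<in> ?A" by (simp add: eqs1_def q1_def q2_def)
    ultimately show ?thesis using roots_cases by (metis (no_types, lifting) image_subsetI insert_subset)
  qed
qed

lemma card_singular_eqs1:
  "card {(\<alpha>, \<beta>, \<gamma>, \<delta>) \<in> eqs1. \<alpha> * \<delta> = \<beta> * \<gamma>} = 1 + card roots"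
proof -
  have 1: "root_solution1 (\<tau>, 1) \<noteq> (0, 0, 0, 0)" "root_solution1 (\<tau>, 1) \<noteq> root_solution1 (1, 0)"
    if "poly h \<tau> = 0" for \<tau>
    using root_derivative_nonzero[OF that] by (simp_all add: root_solution1_simps)
  have 2: "\<tau> = \<tau>'" if "poly h \<tau> = 0" "root_solution1 (\<tau>, 1) = root_solution1 (\<tau>', 1)" for \<tau> \<tau>'
  proof -
    define e e' where "e = q1 (\<tau> ^ 2) 1" and "e' = q1 (\<tau>' ^ 2) 1"
    have "e = e'" "\<tau> / e = \<tau>' / e'" "e \<noteq> 0"
      using that(2) root_derivative_nonzero[OF that(1)]
      by (auto simp: root_solution1_simps simp flip: e_def e'_def)
    then show ?thesis by simp
  qed
  have 3: "root_solution1 (1, 0) \<noteq> (0, 0, 0, 0)" if "a5 = 0"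
  proof -
    have "a4 \<noteq> 0" using that lead by blast
    then show ?thesis by (simp add: root_solution1_simps)
  qed
  have nz: "root_solution1 r \<noteq> (0, 0, 0, 0)" if "r \<in> roots" for r
    using that 1(1) 3 by (cases rule: roots_cases) metis+
  have "inj_on root_solution1 roots"
  proof (rule inj_onI)
    fix r r' assume r: "r \<in> roots" "r' \<in> roots" "root_solution1 r = root_solution1 r'"
    from r(1) show "r = r'"
    proof (cases rule: roots_cases)
      case affine
      from r(2) show ?thesis using affine r(3) 1(2) 2 by (cases rule: roots_cases) metis+
    next
      case infinity
      from r(2) show ?thesis using infinity r(3) 1(2) by (cases rule: roots_cases) metis+
    qed
  qed
  then have "card (root_solution1 ` roots) = card roots" by (rule card_image)
  moreover have "(0, 0, 0, 0) \<notin> root_solution1 ` roots" using nz by force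
  moreover have "finite (root_solution1 ` roots)" by (rule finite)
  ultimately show ?thesis unfolding singular_eqs1 by simp
qed

text \<open>For a root \<tau> the quadratic \<open>\<tau> q1(s, 1) + q2(s, 1)\<close> vanishes at
  \<open>s = \<tau>^2\<close>; let \<open>m1 s + m0\<close> be its cofactor. In the plane
  \<open>x = \<tau> y\<close> the cubic form is then
  \<open>y (z + \<tau>^2 w) (y + m1 z + m0 w)\<close>, and the last factor is
  \<open>root_solution2\<close>. At infinity, y = 0 gives
  \<open>x w (x + a3 z + a1 w)\<close>.\<close>

lemma eqs2_eq: "eqs2 = insert (0, 0, 0, 0) (root_solution2 ` roots)" (is "_ = ?B")
proof
  show "eqs2 \<subseteq> ?B"
  proof (rule subsetI, rule ccontr)
    fix M assume M': "M \<in> eqs2" and "M \<notin> ?B"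
    moreover obtain \<alpha> \<beta> \<gamma> \<delta> where "M = (\<alpha>, \<beta>, \<gamma>, \<delta>)" by (metis prod_cases4)
    ultimately have M: "(\<alpha>, \<beta>, \<gamma>, \<delta>) \<in> eqs2"
      and nim: "(\<alpha>, \<beta>, \<gamma>, \<delta>) \<notin> root_solution2 ` roots"
      and nz: "\<not> (\<alpha> = 0 \<and> \<beta> = 0 \<and> \<gamma> = 0 \<and> \<delta> = 0)"
      by auto
    from M have det: "\<alpha> * \<delta> = \<beta> * \<gamma>" and E: "\<gamma> ^ 2 = a5 * \<alpha> + a4 * \<gamma>"
      "\<alpha> ^ 2 = a3 * \<alpha> + a5 * \<beta> + a2 * \<gamma> + a4 * \<delta>" "\<delta> ^ 2 = a1 * \<alpha> + a3 * \<beta> + a0 * \<gamma> + a2 * \<delta>"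
      "\<beta> ^ 2 = a1 * \<beta> + a0 * \<delta>"
      by (auto simp: eqs2_def)
    have "\<gamma> = 0 \<and> \<delta> = 0"
    proof (rule ccontr)
      assume nz: "\<not> ?thesis"
      obtain \<tau> where \<tau>: "\<alpha> = \<tau> * \<gamma>" "\<beta> = \<tau> * \<delta>"
      proof (cases "\<gamma> = 0")
        case True
        with nz det that[of "\<beta> / \<delta>"] show ?thesis by simp
      next
        case False
        with det that[of "\<alpha> / \<gamma>"] show ?thesis by (simp add: field_simps)
      qed
      \<comment> \<open>Coefficients of \<open>\<tau> q1(s, 1) + q2(s, 1)\<close> as a quadratic in
        \<open>s\<close>; its value at \<open>s = \<tau>^2\<close> is
        \<open>h(\<tau>)\<close>.\<close>
      define p2 p1 p0 where "p2 = a5 * \<tau> + a4" and "p1 = a3 * \<tau> + a2" and "p0 = a1 * \<tau> + a0"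
      have 1: "\<gamma> * \<gamma> = \<gamma> * p2"
        using E(1) unfolding \<tau> by (simp add: p2_def p1_def p0_def algebra_simps power2_eq_square)
      have 2: "\<tau> ^ 2 * \<gamma> ^ 2 = p1 * \<gamma> + p2 * \<delta>"
        using E(2) unfolding \<tau> by (simp add: p2_def p1_def p0_def algebra_simps power2_eq_square)
      have 3: "\<delta> ^ 2 = p0 * \<gamma> + p1 * \<delta>"
        using E(3) unfolding \<tau> by (simp add: p2_def p1_def p0_def algebra_simps power2_eq_square)
      have 4: "\<delta> * (\<tau> ^ 2 * \<delta>) = \<delta> * p0"
        using E(4) unfolding \<tau> by (simp add: p2_def p1_def p0_def algebra_simps power2_eq_square)
      have \<gamma>: "\<gamma> = p2"
      proof (cases "\<gamma> = 0")
        case True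
        then show ?thesis using 2 nz by simp
      next
        case False
        then show ?thesis using 1 by simp
      qed
      have \<delta>: "\<delta> = p1 + \<tau> ^ 2 * p2"
      proof (cases "p2 = 0")
        case True
        then have "\<delta> * \<delta> = \<delta> * p1" "\<delta> \<noteq> 0" using 3 \<gamma> nz by (simp_all add: power2_eq_square mult.commute)
        then show ?thesis using True by simp
      next
        case False
        have "p2 * \<delta> = p2 * (p1 + \<tau> ^ 2 * p2)" using 2 unfolding \<gamma>
          by (metis (no_types, opaque_lifting) add_self(2) distrib_left mult.assoc mult.commute power2_eq_square)
        then show ?thesis using False by simp
      qed
      have poly: "poly h \<tau> = p0 + \<tau> ^ 2 * (p1 + \<tau> ^ 2 * p2)"
        by (simp add: h_def p0_def p1_def p2_def algebra_simps power_numeral_reduce)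
      have "poly h \<tau> = 0"
      proof (cases "\<delta> = 0")
        case True
        then have "p0 * p2 = 0" "p2 \<noteq> 0" using 3 \<gamma> nz by auto
        then have "p0 = 0" by simp
        then show ?thesis using True \<delta> by (simp add: poly)
      next
        case False
        then have "\<tau> ^ 2 * \<delta> = p0" using 4 by simp
        then show ?thesis by (simp add: poly flip: \<delta>)
      qed
      then have "(\<tau>, 1) \<in> roots" by (simp add: roots_def)
      moreover have "(\<alpha>, \<beta>, \<gamma>, \<delta>) = root_solution2 (\<tau>, 1)"
        unfolding \<tau> by (simp add: root_solution2_def \<gamma> \<delta> p2_def p1_def)
      ultimately show False using nim by blast
    qed
    then have E: "a5 * \<alpha> = 0" "\<alpha> ^ 2 = a3 * \<alpha> + a5 * \<beta>" "a1 * \<alpha> = a3 * \<beta>" "\<beta> * \<beta> = \<beta> * a1"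
      using E by (simp_all add: power2_eq_square mult.commute)
    have "\<alpha> = 0 \<and> \<beta> = 0"
    proof (rule ccontr)
      assume nz: "\<not> ?thesis"
      have a5: "a5 = 0"
        using E nz by auto
      then have "(1, 0) \<in> roots" by (rule infinity_in_roots)
      moreover have "\<alpha> = a3 \<and> \<beta> = a1"
      proof (cases "\<alpha> = 0")
        case True
        then show ?thesis using nz E by auto
      next
        case False
        then have "\<alpha> = a3" using E(2) a5 by (simp add: power2_eq_square)
        then show ?thesis using E(3) False by simp
      qed
      then have "(\<alpha>, \<beta>, \<gamma>, \<delta>) = root_solution2 (1, 0)"
        using \<open>\<gamma> = 0 \<and> \<delta> = 0\<close> by (simp add: root_solution2_def)
      ultimately show False using nim by blast
    qed
    with \<open>\<gamma> = 0 \<and> \<delta> = 0\<close> nz show False by blast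
  qed
  show "?B \<subseteq> eqs2"
  proof -
    have "root_solution2 (\<tau>, 1) \<in> eqs2" if \<tau>: "poly h \<tau> = 0" for \<tau>
    proof -
      define p2 p1 p0 where "p2 = a5 * \<tau> + a4" and "p1 = a3 * \<tau> + a2" and "p0 = a1 * \<tau> + a0"
      have "poly h \<tau> = p0 + \<tau> ^ 2 * (p1 + \<tau> ^ 2 * p2)"
        by (simp add: h_def p0_def p1_def p2_def algebra_simps power_numeral_reduce)
      with \<tau> have p0: "p0 = \<tau> ^ 2 * (p1 + \<tau> ^ 2 * p2)" by simp
      have sol: "root_solution2 (\<tau>, 1) = (\<tau> * p2, \<tau> * (p1 + \<tau> ^ 2 * p2), p2, p1 + \<tau> ^ 2 * p2)"
        by (simp add: root_solution2_def p2_def p1_def)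
      have "p2 ^ 2 = (a5 * \<tau> + a4) * p2" "(\<tau> * p2) ^ 2 = (a3 * \<tau> + a2) * p2 + (a5 * \<tau> + a4) * (p1 + \<tau> ^ 2 * p2)"
        "(p1 + \<tau> ^ 2 * p2) ^ 2 = (a1 * \<tau> + a0) * p2 + (a3 * \<tau> + a2) * (p1 + \<tau> ^ 2 * p2)"
        "(\<tau> * (p1 + \<tau> ^ 2 * p2)) ^ 2 = (a1 * \<tau> + a0) * (p1 + \<tau> ^ 2 * p2)"
        unfolding p2_def[symmetric] p1_def[symmetric] p0_def[symmetric] p0
        by (simp_all add: algebra_simps power_numeral_reduce)
      then show ?thesis unfolding sol eqs2_def by (simp add: algebra_simps)
    qed
    moreover have "root_solution2 (1, 0) \<in> eqs2" if "a5 = 0"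
      using that unfolding eqs2_def root_solution2_def by (simp add: power2_eq_square mult.commute)
    moreover have "(0, 0, 0, 0) \<in> eqs2" by (simp add: eqs2_def)
    ultimately show ?thesis using roots_cases by (metis (no_types, lifting) image_subsetI insert_subset)
  qed
qed

lemma card_eqs2: "card eqs2 = 1 + card roots"
proof -
  define m1 m0 where "m1 \<tau> = a5 * \<tau> + a4" and "m0 \<tau> = a3 * \<tau> + a2 + \<tau> ^ 2 * (a5 * \<tau> + a4)" for \<tau>
  have nz1: "(m1 \<tau>, m0 \<tau>) \<noteq> (0, 0)" if \<tau>: "poly h \<tau> = 0" for \<tau>
  proof
    assume "(m1 \<tau>, m0 \<tau>) = (0, 0)"
    then have 0: "a5 * \<tau> = a4" "a3 * \<tau> = a2" by (auto simp: m1_def m0_def)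
    have "poly h \<tau> = (a1 * \<tau> + a0) + \<tau> ^ 2 * ((a3 * \<tau> + a2) + \<tau> ^ 2 * (a5 * \<tau> + a4))"
      by (simp add: h_def algebra_simps power_numeral_reduce)
    with \<tau> 0 have "a1 * \<tau> = a0" by simp
    with 0 not_proportional[of \<tau> 1] show False by (simp add: mult.commute)
  qed
  have nz2: "a3 \<noteq> 0 \<or> a1 \<noteq> 0" if "a5 = 0" using not_proportional[of 1 0] that by auto
  have sol1: "root_solution2 (\<tau>, 1) = (\<tau> * m1 \<tau>, \<tau> * m0 \<tau>, m1 \<tau>, m0 \<tau>)" for \<tau>
    by (simp add: root_solution2_def m1_def m0_def)
  have sol2: "root_solution2 (1, 0) = (a3, a1, 0, 0)" by (simp add: root_solution2_def)
  have inj: "\<tau> = \<tau>'" if "poly h \<tau> = 0" "root_solution2 (\<tau>, 1) = root_solution2 (\<tau>', 1)" for \<tau> \<tau>'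
  proof -
    have "m1 \<tau> \<noteq> 0 \<or> m0 \<tau> \<noteq> 0" using nz1[OF that(1)] by blast
    moreover have "\<tau> * m1 \<tau> = \<tau>' * m1 \<tau> \<and> \<tau> * m0 \<tau> = \<tau>' * m0 \<tau>" using that(2) unfolding sol1 by auto
    ultimately show ?thesis by auto
  qed
  have inj2: "root_solution2 (\<tau>, 1) \<noteq> root_solution2 (1, 0)" if "poly h \<tau> = 0" for \<tau>
    using nz1[OF that] unfolding sol1 sol2 by blast
  have nz: "root_solution2 r \<noteq> (0, 0, 0, 0)" if "r \<in> roots" for r
    using that
  proof (cases rule: roots_cases)
    case (affine \<tau>)
    then show ?thesis using nz1[of \<tau>] unfolding affine(2) sol1 by blast
  next
    case infinity
    then show ?thesis using nz2 unfolding infinity(2) sol2 by blast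
  qed
  have "inj_on root_solution2 roots"
  proof (rule inj_onI)
    fix r r' assume r: "r \<in> roots" "r' \<in> roots" "root_solution2 r = root_solution2 r'"
    from r(1) show "r = r'"
    proof (cases rule: roots_cases)
      case affine
      from r(2) show ?thesis using affine r(3) inj inj2 by (cases rule: roots_cases) metis+
    next
      case infinity
      from r(2) show ?thesis using infinity r(3) inj2 by (cases rule: roots_cases) metis+
    qed
  qed
  then have "card (root_solution2 ` roots) = card roots" by (rule card_image)
  moreover have "(0, 0, 0, 0) \<notin> root_solution2 ` roots" using nz by force
  moreover have "finite (root_solution2 ` roots)" by (rule finite)
  ultimately show ?thesis unfolding eqs2_eq by simp
qed

subsection \<open>Graphs of invertible matrices and cubic factors\<close>

text \<open>The last condition says that the complementary factor of the quintic form has degree at most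
  two; a factor of degree below three accounts for the root at infinity.\<close>
definition cubic_factors :: "'a poly set" where
  "cubic_factors = {g. lead_coeff g = 1 \<and> g dvd h \<and> degree g \<le> 3 \<and> degree h \<le> degree g + 2}"

lemma degree_h: "degree h = (if a5 = 0 then 4 else 5)"
  using lead by (auto simp: h_def)

text \<open>The restriction of \<open>F\<close> to the graph of the matrix is the sum of this polynomial and
  $g = [:\<beta>, \<alpha>, \<delta>, \<gamma>:]$.\<close>
definition restriction where
  "restriction \<alpha> \<beta> \<gamma> \<delta> = [:q2 \<beta> \<delta>, a2 * (\<alpha> * \<delta> + \<beta> * \<gamma>) + q1 \<beta> \<delta>,
     a3 * (\<alpha> * \<delta> + \<beta> * \<gamma>) + q2 \<alpha> \<gamma>, q1 \<alpha> \<gamma>:]"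

lemma eqs1_iff_restriction: "(\<alpha>, \<beta>, \<gamma>, \<delta>) \<in> eqs1 \<longleftrightarrow> restriction \<alpha> \<beta> \<gamma> \<delta> = [:\<beta>, \<alpha>, \<delta>, \<gamma>:]"
  unfolding eqs1_def restriction_def mem_Collect_eq prod.case pCons_eq_iff by (auto simp only:)

text \<open>This is \<open>graph_identity\<close> for polynomials, with \<open>T\<close> the
  indeterminate and \<open>Z\<close>, \<open>W\<close> the values of z and w on the graph at (x, y)
  = (T, 1).\<close>

lemma restriction_identity:
  fixes \<alpha> \<beta> \<gamma> \<delta> :: 'a
  defines "g \<equiv> [:\<beta>, \<alpha>, \<delta>, \<gamma>:]"
  shows "[:\<delta>, \<gamma>:] ^ 2 * h = g * ([:a4, a5:] * g + [:a2, a3:] * [:\<delta>, \<gamma>:]) + restriction \<alpha> \<beta> \<gamma> \<delta>"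
proof -
  define T :: "'a poly" where "T = [:0, 1:]"
  define W where "W = [:\<delta>, \<gamma>:]"
  define Z where "Z = [:\<beta>, \<alpha>:]"
  have 2: "(2 :: 'a poly) = 0" by (simp add: numeral_poly)
  have h: "h = [:a0:] + [:a1:] * T + [:a2:] * T ^ 2 + [:a3:] * T ^ 3 + [:a4:] * T ^ 4 + [:a5:] * T ^ 5"
    by (simp add: h_def T_def power_numeral_reduce)
  have g: "g = W * T ^ 2 + Z" by (simp add: g_def W_def T_def Z_def power_numeral_reduce)
  have K: "[:a4, a5:] = [:a5:] * T + [:a4:]" "[:a2, a3:] = [:a3:] * T + [:a2:]" by (simp_all add: T_def)
  have R: "restriction \<alpha> \<beta> \<gamma> \<delta> = T * ([:a5:] * Z ^ 2 + [:a3:] * Z * W + [:a1:] * W ^ 2)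
     + ([:a4:] * Z ^ 2 + [:a2:] * Z * W + [:a0:] * W ^ 2)"
    by (simp add: restriction_def T_def W_def Z_def q1_def q2_def power2_eq_square algebra_simps)
  show ?thesis
    unfolding R W_def[symmetric] K h g by (rule graph_identity[OF 2])
qed

text \<open>When the restriction equals \<open>g\<close>, the identity makes \<open>g\<close> divide
  \<open>W^2 h\<close>. An invertible matrix makes \<open>W\<close> a unit modulo \<open>g\<close>,
  so \<open>g\<close> divides \<open>h\<close>.\<close>

lemma dvd_of_eqs1:
  assumes M: "(\<alpha>, \<beta>, \<gamma>, \<delta>) \<in> eqs1" and D: "\<alpha> * \<delta> \<noteq> \<beta> * \<gamma>"
  shows "[:\<beta>, \<alpha>, \<delta>, \<gamma>:] dvd h"
proof -
  define g where "g = [:\<beta>, \<alpha>, \<delta>, \<gamma>:]"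
  define W where "W = [:\<delta>, \<gamma>:]"
  define e where "e = [:\<alpha>, 0, \<gamma>:]"
  define D where "D = \<alpha> * \<delta> + \<beta> * \<gamma>"
  have "restriction \<alpha> \<beta> \<gamma> \<delta> = g" using M unfolding eqs1_iff_restriction g_def .
  moreover have "W ^ 2 * h = g * ([:a4, a5:] * g + [:a2, a3:] * W) + restriction \<alpha> \<beta> \<gamma> \<delta>"
    unfolding g_def W_def by (rule restriction_identity)
  ultimately have "W ^ 2 * h = g * ([:a4, a5:] * g + [:a2, a3:] * W + 1)"
    by (simp only: distrib_left mult_1_right)
  then have dvd: "g dvd e ^ 2 * (W ^ 2 * h)" by (metis dvd_triv_left dvd_mult)
  \<comment> \<open>A Bezout relation: modulo \<open>g\<close>, the inverse of \<open>W\<close> is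
    \<open>e / D\<close>.\<close>
  have DD: "[:D:] = [:\<gamma>:] * g + e * W"
    by (simp add: g_def W_def e_def D_def algebra_simps)
  have "[:D:] ^ 2 * h = g * ([:\<gamma>:] ^ 2 * g + 2 * [:\<gamma>:] * e * W) * h + e ^ 2 * (W ^ 2 * h)"
    unfolding DD by (simp only: power2_eq_square algebra_simps mult_2 distrib_left distrib_right)
  then have "g dvd [:D:] ^ 2 * h" using dvd by (simp add: dvd_add mult.assoc)
  moreover have "[:D:] ^ 2 * h = smult (D ^ 2) h" by (simp add: power2_eq_square)
  moreover have "D \<noteq> 0" using assms by (simp add: D_def)
  ultimately show ?thesis by (simp add: dvd_smult_iff g_def)
qed

definition monic :: "'a poly \<Rightarrow> 'a poly" where
  "monic g = smult (inverse (lead_coeff g)) g"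

lemma lead_coeff_monic: "g \<noteq> 0 \<Longrightarrow> lead_coeff (monic g) = 1"
  by (simp add: monic_def)

lemma degree_monic [simp]: "degree (monic g) = degree g"
  by (simp add: monic_def)

lemma monic_eq: "lead_coeff g = 1 \<Longrightarrow> c \<noteq> 0 \<Longrightarrow> monic (smult c g) = g"
  by (simp add: monic_def)

fun graph_factor where
  "graph_factor (\<alpha>, \<beta>, \<gamma>, \<delta>) = monic [:\<beta>, \<alpha>, \<delta>, \<gamma>:]"

abbreviation "regular_eqs1 \<equiv> {(\<alpha>, \<beta>, \<gamma>, \<delta>) \<in> eqs1. \<alpha> * \<delta> \<noteq> \<beta> * \<gamma>}"

lemma graph_factor_in: 
  assumes "M \<in> regular_eqs1"
  shows "graph_factor M \<in> cubic_factors"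
proof -
  obtain \<alpha> \<beta> \<gamma> \<delta> where M: "M = (\<alpha>, \<beta>, \<gamma>, \<delta>)" by (metis prod_cases4)
  have E: "(\<alpha>, \<beta>, \<gamma>, \<delta>) \<in> eqs1" and D: "\<alpha> * \<delta> \<noteq> \<beta> * \<gamma>"
    using assms M by auto
  define g where "g = [:\<beta>, \<alpha>, \<delta>, \<gamma>:]"
  have "g \<noteq> 0" using D by (auto simp: g_def)
  have "g dvd h" unfolding g_def by (rule dvd_of_eqs1[OF E D])
  then have "monic g dvd h" using \<open>g \<noteq> 0\<close> by (simp add: monic_def smult_dvd_iff)
  moreover have "degree g \<le> 3" by (simp add: g_def)
  moreover have "degree h \<le> degree g + 2"
  \<comment> \<open>The factor drops to degree two only if infinity is a root: with \<gamma> = 0 the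
    equation for \<gamma> reads \<open>a5 \<alpha>^2 = 0\<close>.\<close>
  proof (cases "\<gamma> = 0")
    case True
    then have "\<delta> \<noteq> 0" "\<alpha> \<noteq> 0" using D by auto
    moreover have "q1 \<alpha> \<gamma> = \<gamma>" using E unfolding eqs1_def mem_Collect_eq prod.case by metis
    ultimately have "a5 = 0" using True by (simp add: q1_def)
    then have "degree h = 4" unfolding degree_h by simp
    then show ?thesis using True \<open>\<delta> \<noteq> 0\<close> by (simp add: g_def)
  next
    case False
    then show ?thesis by (simp add: degree_h g_def)
  qed
  ultimately show ?thesis
    using lead_coeff_monic[OF \<open>g \<noteq> 0\<close>] by (simp add: M cubic_factors_def flip: g_def)
qed

lemma restriction_scale:
  "restriction (c * \<alpha>) (c * \<beta>) (c * \<gamma>) (c * \<delta>) = smult (c ^ 2) (restriction \<alpha> \<beta> \<gamma> \<delta>)"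
  by (simp add: restriction_def q1_def q2_def power2_eq_square algebra_simps)

text \<open>Equal monic factors mean proportional matrices. The restriction is quadratic in the
  matrix while \<open>g\<close> is linear, so the ratio satisfies \<open>c^2 = c\<close>.\<close>

lemma inj_on_graph_factor: "inj_on graph_factor regular_eqs1"
proof (rule inj_onI)
  fix M M' assume MM: "M \<in> regular_eqs1" "M' \<in> regular_eqs1" "graph_factor M = graph_factor M'"
  obtain \<alpha> \<beta> \<gamma> \<delta> where M: "M = (\<alpha>, \<beta>, \<gamma>, \<delta>)" by (metis prod_cases4)
  obtain \<alpha>' \<beta>' \<gamma>' \<delta>' where M': "M' = (\<alpha>', \<beta>', \<gamma>', \<delta>')" by (metis prod_cases4)
  define g g' where "g = [:\<beta>, \<alpha>, \<delta>, \<gamma>:]" and "g' = [:\<beta>', \<alpha>', \<delta>', \<gamma>':]"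
  have E: "restriction \<alpha> \<beta> \<gamma> \<delta> = g" "restriction \<alpha>' \<beta>' \<gamma>' \<delta>' = g'" and nz: "g \<noteq> 0" "g' \<noteq> 0"
    using MM(1,2) by (auto simp: M M' eqs1_iff_restriction g_def g'_def)
  define c where "c = lead_coeff g' / lead_coeff g"
  have c0: "c \<noteq> 0" using nz by (simp add: c_def)
  have "smult (lead_coeff g') (monic g) = smult (lead_coeff g') (monic g')"
    using MM(3) by (simp add: M M' g_def g'_def)
  then have g': "g' = smult c g" using nz by (simp add: monic_def c_def divide_inverse)
  then have *: "\<alpha>' = c * \<alpha>" "\<beta>' = c * \<beta>" "\<gamma>' = c * \<gamma>" "\<delta>' = c * \<delta>"
    by (simp_all add: g_def g'_def)
  have "smult c g = smult (c ^ 2) g"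
    using E(2) unfolding * restriction_scale E(1) g' by simp
  then have "smult (c ^ 2 - c) g = 0" by (simp add: smult_diff_left del: diff_eq)
  then have "c * c = c * 1" using nz by (simp add: power2_eq_square)
  then have "c = 1" using c0 by (simp only: mult_cancel_left) simp
  then show "M = M'" using * by (simp add: M M')
qed

text \<open>Otherwise $q_1$ and $q_2$ would be multiples of the two linear forms of the inverse matrix by one
  linear form, whose zero is common to both.\<close>
lemma restriction_nonzero:
  assumes D: "\<alpha> * \<delta> \<noteq> \<beta> * \<gamma>"
  shows "restriction \<alpha> \<beta> \<gamma> \<delta> \<noteq> 0"
proof
  assume "restriction \<alpha> \<beta> \<gamma> \<delta> = 0"
  then have 0: "q2 \<beta> \<delta> = 0" "a2 * (\<alpha> * \<delta> + \<beta> * \<gamma>) = q1 \<beta> \<delta>" "a3 * (\<alpha> * \<delta> + \<beta> * \<gamma>) = q2 \<alpha> \<gamma>" "q1 \<alpha> \<gamma> = 0"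
    by (simp_all add: restriction_def)
  define \<kappa> where "\<kappa> = q2 \<alpha> \<gamma>"
  have "\<kappa> \<noteq> 0" using no_common_zero[OF 0(4)] D by (auto simp: \<kappa>_def)
  define t where "t = q1 \<beta> \<delta> / \<kappa>"
  have t: "q1 \<beta> \<delta> = \<kappa> * t" using \<open>\<kappa> \<noteq> 0\<close> by (simp add: t_def)
  have "q1 (\<alpha> * t + \<beta>) (\<gamma> * t + \<delta>) = q1 \<alpha> \<gamma> * t ^ 2 + a3 * (\<alpha> * \<delta> + \<beta> * \<gamma>) * t + q1 \<beta> \<delta>"
    by (simp add: q1_def power2_eq_square algebra_simps)
  also have "\<dots> = 0" by (simp add: 0 t flip: \<kappa>_def)
  finally have 1: "q1 (\<alpha> * t + \<beta>) (\<gamma> * t + \<delta>) = 0" .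
  have "q2 (\<alpha> * t + \<beta>) (\<gamma> * t + \<delta>) = q2 \<alpha> \<gamma> * t ^ 2 + a2 * (\<alpha> * \<delta> + \<beta> * \<gamma>) * t + q2 \<beta> \<delta>"
    by (simp add: q2_def power2_eq_square algebra_simps)
  also have "\<dots> = 0" by (simp add: 0 t power2_eq_square flip: \<kappa>_def)
  finally have "\<alpha> * t + \<beta> = 0 \<and> \<gamma> * t + \<delta> = 0" using no_common_zero[OF 1] by blast
  then have "\<beta> = \<alpha> * t" "\<delta> = \<gamma> * t" by auto
  with D show False by simp
qed

text \<open>For a singular matrix \<open>Z\<close> and \<open>W\<close> are proportional, so
  \<open>W T^2 + Z\<close> contains a factor \<open>T^2 + r\<close>, a square in characteristic
  two.\<close>

lemma determinant_of_factor:
  assumes "[:\<beta>, \<alpha>, \<delta>, \<gamma>:] dvd h" "\<gamma> \<noteq> 0 \<or> \<delta> \<noteq> 0"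
  shows "\<alpha> * \<delta> \<noteq> \<beta> * \<gamma>"
proof
  assume D: "\<alpha> * \<delta> = \<beta> * \<gamma>"
  obtain m where m: "h = [:\<beta>, \<alpha>, \<delta>, \<gamma>:] * m" using assms(1) by blast
  have sq: "[:\<tau>, 1:] ^ 2 = [:\<tau> ^ 2, 0, 1:]" for \<tau> :: 'a by (simp add: power2_eq_square)
  show False
  proof (cases "\<gamma> = 0")
    case False
    obtain \<tau> where \<tau>: "\<tau> ^ 2 = \<alpha> / \<gamma>" by (rule sqrt)
    have "[:\<beta>, \<alpha>, \<delta>, \<gamma>:] = [:\<tau>, 1:] ^ 2 * [:\<delta>, \<gamma>:]"
      unfolding sq \<tau> using False D by (simp add: field_simps)
    then have "h = [:\<tau>, 1:] ^ 2 * ([:\<delta>, \<gamma>:] * m)" by (simp only: m mult.assoc)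
    then show False using square_factor_const by fastforce
  next
    case True
    with assms D have "\<delta> \<noteq> 0" "\<alpha> = 0" by auto
    obtain \<tau> where \<tau>: "\<tau> ^ 2 = \<beta> / \<delta>" by (rule sqrt)
    have "[:\<beta>, \<alpha>, \<delta>, \<gamma>:] = [:\<tau>, 1:] ^ 2 * [:\<delta>:]"
      unfolding sq \<tau> using True \<open>\<delta> \<noteq> 0\<close> \<open>\<alpha> = 0\<close> by simp
    then have "h = [:\<tau>, 1:] ^ 2 * ([:\<delta>:] * m)" by (simp only: m mult.assoc)
    then show False using square_factor_const by fastforce
  qed
qed

text \<open>For the matrix read off from \<open>g\<close>, the identity shows that \<open>g\<close>
  divides the restriction. By degrees the quotient is a nonzero constant \<mu>, and scaling the
  matrix by 1/\<mu> makes the restriction equal to the polynomial of the scaled matrix.\<close>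

lemma graph_factor_surj:
  assumes "g \<in> cubic_factors"
  shows "g \<in> graph_factor ` regular_eqs1"
proof -
  have g: "lead_coeff g = 1" "g dvd h" "degree g \<le> 3" "degree h \<le> degree g + 2"
    using assms by (auto simp: cubic_factors_def)
  define \<alpha> \<beta> \<gamma> \<delta> where "\<alpha> = coeff g 1" and "\<beta> = coeff g 0" and "\<gamma> = coeff g 3" and "\<delta> = coeff g 2"
  have g_eq: "g = [:\<beta>, \<alpha>, \<delta>, \<gamma>:]"
  proof (rule poly_eqI)
    fix n
    have "coeff g n = 0" if "n > 3" using that g(3) by (intro coeff_eq_0) simp
    then show "coeff g n = coeff [:\<beta>, \<alpha>, \<delta>, \<gamma>:] n"
      by (auto simp: \<alpha>_def \<beta>_def \<gamma>_def \<delta>_def coeff_pCons numeral_eq_Suc split: nat.splits)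
  qed
  have "degree g \<ge> 2" using g(4) degree_h by (auto split: if_splits)
  then have gd: "\<gamma> \<noteq> 0 \<or> \<delta> \<noteq> 0" unfolding g_eq by (auto split: if_splits)
  have D: "\<alpha> * \<delta> \<noteq> \<beta> * \<gamma>" using determinant_of_factor[OF _ gd] g(2) unfolding g_eq by blast
  define R where "R = restriction \<alpha> \<beta> \<gamma> \<delta>"
  have "R \<noteq> 0" unfolding R_def by (rule restriction_nonzero[OF D])
  have "g dvd R"
  proof -
    have "g dvd [:\<delta>, \<gamma>:] ^ 2 * h" using g(2) by (rule dvd_mult)
    moreover have "[:\<delta>, \<gamma>:] ^ 2 * h = g * ([:a4, a5:] * g + [:a2, a3:] * [:\<delta>, \<gamma>:]) + R"
      using restriction_identity[of \<delta> \<gamma> \<beta> \<alpha>] by (simp only: R_def flip: g_eq)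
    ultimately show ?thesis by (metis dvd_add_right_iff dvd_triv_left)
  qed
  then obtain m where m: "R = g * m" by blast
  \<comment> \<open>If \<open>g\<close> has degree two, then \<open>a5 = 0\<close>, and the leading
    coefficient \<open>q1 \<alpha> 0\<close> of the restriction disappears as well.\<close>
  have "degree R \<le> degree g"
  proof (cases "\<gamma> = 0")
    case True
    then have "degree g = 2" using gd by (simp add: g_eq)
    then have "a5 = 0" using g(4) degree_h by (auto split: if_splits)
    then have "q1 \<alpha> \<gamma> = 0" using True unfolding q1_def by simp
    then have "degree R \<le> 2" unfolding R_def restriction_def by simp
    then show ?thesis using \<open>degree g = 2\<close> by simp
  next
    case False
    then show ?thesis by (simp add: R_def restriction_def g_eq)
  qed
  moreover have "degree R = degree g + degree m"
    using \<open>R \<noteq> 0\<close> unfolding m by (intro degree_mult_eq) auto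
  ultimately have "degree m = 0" by simp
  then obtain \<mu> where "m = [:\<mu>:]" by (rule degree_eq_zeroE)
  then have R: "R = smult \<mu> g" "\<mu> \<noteq> 0" using m \<open>R \<noteq> 0\<close> by auto
  define c where "c = 1 / \<mu>"
  have "restriction (c * \<alpha>) (c * \<beta>) (c * \<gamma>) (c * \<delta>) = smult c g"
    unfolding restriction_scale R_def[symmetric] R(1) using R(2) by (simp add: c_def power2_eq_square)
  then have "(c * \<alpha>, c * \<beta>, c * \<gamma>, c * \<delta>) \<in> eqs1"
    unfolding eqs1_iff_restriction g_eq by simp
  moreover have "(c * \<alpha>) * (c * \<delta>) \<noteq> (c * \<beta>) * (c * \<gamma>)"
  proof -
    have "c ^ 2 * (\<alpha> * \<delta>) \<noteq> c ^ 2 * (\<beta> * \<gamma>)" using D R(2) by (simp add: c_def)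
    then show ?thesis by (simp add: power2_eq_square mult_ac)
  qed
  moreover have "graph_factor (c * \<alpha>, c * \<beta>, c * \<gamma>, c * \<delta>) = g"
  proof -
    have "[:c * \<beta>, c * \<alpha>, c * \<delta>, c * \<gamma>:] = smult c g" by (simp add: g_eq)
    then show ?thesis using monic_eq[OF g(1), of c] R(2) by (simp add: c_def)
  qed
  ultimately show ?thesis by (intro image_eqI[of _ _ "(c * \<alpha>, c * \<beta>, c * \<gamma>, c * \<delta>)"]) simp_all
qed

lemma card_regular_eqs1: "card regular_eqs1 = card cubic_factors"
proof -
  have "graph_factor ` regular_eqs1 = cubic_factors"
    using graph_factor_in graph_factor_surj by blast
  then show ?thesis using card_image[OF inj_on_graph_factor] by simp
qed

lemma card_k_lines_F: "card (k_lines F) = 2 + 3 * card roots + card cubic_factors"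
proof -
  have "eqs1 = {(\<alpha>, \<beta>, \<gamma>, \<delta>) \<in> eqs1. \<alpha> * \<delta> = \<beta> * \<gamma>} \<union> regular_eqs1" by auto
  moreover have "{(\<alpha>, \<beta>, \<gamma>, \<delta>) \<in> eqs1. \<alpha> * \<delta> = \<beta> * \<gamma>} \<inter> regular_eqs1 = {}" by auto
  moreover have "finite {(\<alpha>, \<beta>, \<gamma>, \<delta>) \<in> eqs1. \<alpha> * \<delta> = \<beta> * \<gamma>}" "finite regular_eqs1"
    by (rule finite)+
  ultimately have "card eqs1 = card {(\<alpha>, \<beta>, \<gamma>, \<delta>) \<in> eqs1. \<alpha> * \<delta> = \<beta> * \<gamma>} + card regular_eqs1"
    by (metis (no_types, lifting) card_Un_disjoint)
  then show ?thesis
    by (simp only: card_k_lines card_eqs2 card_singular_eqs1 card_regular_eqs1)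
qed

lemma card_roots: "card roots = card {\<tau>. poly h \<tau> = 0} + (if a5 = 0 then 1 else 0)"
proof -
  define A where "A = {\<tau>. poly h \<tau> = 0}"
  define S where "S = (\<lambda>\<tau>. (\<tau>, 1 :: 'a)) ` A"
  have "roots = S \<union> (if a5 = 0 then {(1, 0)} else {})"
    unfolding roots_def S_def A_def by blast
  moreover have "card S = card A" unfolding S_def by (intro card_image inj_onI) simp
  moreover have "(1, 0) \<notin> S" by (auto simp: S_def)
  moreover have "finite S" by (rule finite)
  ultimately show ?thesis unfolding A_def[symmetric] by (cases "a5 = 0") simp_all
qed

end

subsection \<open>Products of monic irreducible polynomials\<close>

lemma field_poly_bezout:
  fixes a b :: "'a::field poly"
  obtains u v where "u * a + v * b dvd a" "u * a + v * b dvd b"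
proof -
  have "\<exists>u v. u * a + v * b dvd a \<and> u * a + v * b dvd b"
  \<comment> \<open>Euclid's algorithm. The shift by \<open>Suc\<close> makes a nonzero constant
    \<open>b\<close> larger than a zero remainder.\<close>
  proof (induction "if b = 0 then 0 else Suc (degree b)" arbitrary: a b rule: less_induct)
    case less
    show ?case
    proof (cases "b = 0")
      case True
      then have "1 * a + 0 * b dvd a \<and> 1 * a + 0 * b dvd b" by simp
      then show ?thesis by blast
    next
      case False
      then have "(if a mod b = 0 then 0 else Suc (degree (a mod b))) < (if b = 0 then 0 else Suc (degree b))"
        using degree_mod_less'[of b a] by auto
      from less[OF this] obtain u v
        where uv: "u * b + v * (a mod b) dvd b" "u * b + v * (a mod b) dvd a mod b" by blast
      have "u * b + v * (a mod b) = v * a + (u - v * (a div b)) * b"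
        by (simp add: minus_div_mult_eq_mod[symmetric] algebra_simps)
      moreover have "u * b + v * (a mod b) dvd a"
        using uv by (simp add: dvd_mod_iff)
      ultimately show ?thesis using uv(1) by metis
    qed
  qed
  then show ?thesis using that by blast
qed

lemma field_poly_irreducible_imp_prime_elem:
  fixes p :: "'a::field poly"
  assumes "irreducible p"
  shows "prime_elem p"
proof (rule prime_elemI)
  show "p \<noteq> 0" "\<not> is_unit p" using assms by (auto simp: irreducible_def)
  fix a b assume ab: "p dvd a * b"
  show "p dvd a \<or> p dvd b"
  proof (cases "p dvd a")
    case False
    obtain u v where uv: "u * p + v * a dvd p" "u * p + v * a dvd a" by (rule field_poly_bezout)
    define g where "g = u * p + v * a"
    obtain k where k: "p = g * k" using uv(1) unfolding g_def by blast
    have "\<not> is_unit k"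
    proof
      assume "is_unit k"
      then have "p dvd g" unfolding k by (simp add: mult_unit_dvd_iff)
      then show False using uv(2) False unfolding g_def by (metis dvd_trans)
    qed
    then have "is_unit g" using irreducibleD[OF assms k] by blast
    have "g * b = u * b * p + v * (a * b)" by (simp add: g_def algebra_simps)
    then have "p dvd g * b" using ab by simp
    then show ?thesis using \<open>is_unit g\<close> by (simp add: dvd_mult_unit_iff')
  qed simp
qed

lemma irreducible_monic_dvd_eq:
  fixes p q :: "'a::field poly"
  assumes "irreducible p" "irreducible q" "lead_coeff p = 1" "lead_coeff q = 1" "p dvd q"
  shows "p = q"
proof -
  obtain k where k: "q = p * k" using assms(5) by blast
  have "\<not> is_unit p" using assms(1) by (simp add: irreducible_def)
  then have "is_unit k" using irreducibleD[OF assms(2) k] by blast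
  then obtain c where c: "k = [:c:]" by (auto simp: is_unit_poly_iff)
  have "lead_coeff q = lead_coeff p * lead_coeff k" by (simp only: k lead_coeff_mult)
  then have "c = 1" using c assms(3,4) by simp
  then show ?thesis using k c by simp
qed

definition monic_irreducibles :: "'a::field poly set" where
  "monic_irreducibles = {p. irreducible p \<and> lead_coeff p = 1}"

lemma prime_elem_dvd_prod:
  fixes p :: "'a::comm_semiring_1"
  assumes "prime_elem p" "finite S" "p dvd \<Prod>S"
  shows "\<exists>q\<in>S. p dvd q"
  using assms(2,3)
  by (induction S rule: finite_induct)
    (use assms(1) in \<open>auto simp: prime_elem_dvd_mult_iff prime_elem_not_unit\<close>)

lemma dvd_prod_monic_irreducibles:
  assumes "finite S" "S \<subseteq> monic_irreducibles" "p \<in> monic_irreducibles" "p dvd \<Prod>S"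
  shows "p \<in> S"
proof -
  have "prime_elem p" using assms(3) by (auto simp: monic_irreducibles_def intro: field_poly_irreducible_imp_prime_elem)
  then obtain q where "q \<in> S" "p dvd q"
    using prime_elem_dvd_prod[OF _ assms(1,4)] by blast
  then show ?thesis
    using assms(2,3) irreducible_monic_dvd_eq[of p q] by (auto simp: monic_irreducibles_def)
qed

lemma monic_prod_monic_irreducibles:
  "S \<subseteq> monic_irreducibles \<Longrightarrow> lead_coeff (\<Prod>S) = 1"
  unfolding lead_coeff_prod by (intro prod.neutral) (auto simp: monic_irreducibles_def)

text \<open>By induction: a new prime \<open>p\<close> either divides \<open>g\<close> and is
  cancelled from it, or divides the cofactor and is cancelled there.\<close>

lemma monic_divisors_prod:
  assumes "finite S" "S \<subseteq> monic_irreducibles"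
  shows "{g. lead_coeff g = 1 \<and> g dvd \<Prod>S} = (\<lambda>T. \<Prod>T) ` Pow S"
  using assms
proof (induction S rule: finite_induct)
  case empty
  have "g = 1" if "lead_coeff g = 1" "is_unit g" for g :: "'a poly"
    using that by (auto simp: is_unit_poly_iff)
  then have "{g. lead_coeff g = 1 \<and> g dvd 1} = {1 :: 'a poly}" by auto
  then show ?case by simp
next
  case (insert p S)
  then have S: "S \<subseteq> monic_irreducibles" and p: "p \<in> monic_irreducibles" by auto
  have "prime_elem p" using p by (auto simp: monic_irreducibles_def intro: field_poly_irreducible_imp_prime_elem)
  then have p0: "p \<noteq> 0" by auto
  show ?case
  proof (intro equalityI subsetI)
    fix g assume "g \<in> {g. lead_coeff g = 1 \<and> g dvd \<Prod>(insert p S)}"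
    then have g: "lead_coeff g = 1" and "g dvd p * \<Prod>S"
      using insert.hyps by auto
    then obtain k where k: "p * \<Prod>S = g * k" by blast
    show "g \<in> (\<lambda>T. \<Prod>T) ` Pow (insert p S)"
    proof (cases "p dvd g")
      case True
      then obtain g' where g': "g = p * g'" by blast
      then have "p * \<Prod>S = p * (g' * k)" using k by (simp add: mult.assoc)
      then have "g' dvd \<Prod>S" using p0 by simp
      moreover have "lead_coeff g' = 1" using g p unfolding g' by (simp add: lead_coeff_mult monic_irreducibles_def)
      ultimately obtain T where T: "T \<subseteq> S" "g' = \<Prod>T" using insert.IH[OF S] by blast
      then have "g = \<Prod>(insert p T)"
        using insert.hyps finite_subset unfolding g' by (subst prod.insert) auto
      then show ?thesis using T by blast
    next
      case False
      have "p dvd g * k" using k by (metis dvd_triv_left)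
      then obtain k' where "k = p * k'" using False \<open>prime_elem p\<close> by (auto simp: prime_elem_dvd_mult_iff)
      then have "p * \<Prod>S = p * (g * k')" using k by (simp add: mult_ac)
      then have "g dvd \<Prod>S" using p0 by simp
      then show ?thesis using g insert.IH[OF S] by blast
    qed
  next
    fix g assume "g \<in> (\<lambda>T. \<Prod>T) ` Pow (insert p S)"
    then obtain T where T: "T \<subseteq> insert p S" "g = \<Prod>T" by blast
    then have "g dvd \<Prod>(insert p S)" using insert.hyps unfolding T(2) by (intro prod_dvd_prod_subset) auto
    moreover have "lead_coeff g = 1" using T insert.prems unfolding T(2) by (intro monic_prod_monic_irreducibles) auto
    ultimately show "g \<in> {g. lead_coeff g = 1 \<and> g dvd \<Prod>(insert p S)}" by blast
  qed
qed

lemma inj_on_prod_monic_irreducibles: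
  assumes "finite S" "S \<subseteq> monic_irreducibles"
  shows "inj_on (\<lambda>T. \<Prod>T) (Pow S)"
proof (rule inj_onI)
  have sub: "T \<subseteq> T'" if "T \<subseteq> S" "T' \<subseteq> S" "\<Prod>T = \<Prod>T'" for T T'
  proof
    fix p assume "p \<in> T"
    then have "p dvd \<Prod>T'" using that assms by (metis dvd_prodI finite_subset)
    moreover have "finite T'" "T' \<subseteq> monic_irreducibles" "p \<in> monic_irreducibles"
      using \<open>p \<in> T\<close> that assms finite_subset[OF that(2)] by blast+
    ultimately show "p \<in> T'" using dvd_prod_monic_irreducibles[of T' p] by blast
  qed
  fix T T' assume "T \<in> Pow S" "T' \<in> Pow S" "\<Prod>T = \<Prod>T'"
  then show "T = T'" using sub[of T T'] sub[of T' T] by auto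
qed

text \<open>Up to a unit \<open>g\<close> is a subproduct; a prime \<open>p\<close> in it would give
  \<open>p^2\<close> dividing the full product, hence \<open>p\<close> dividing the product of the
  other primes.\<close>

lemma squarefree_prod_monic_irreducibles:
  assumes "finite S" "S \<subseteq> monic_irreducibles"
  shows "squarefree (\<Prod>S)"
proof (rule squarefreeI)
  fix g assume g: "g ^ 2 dvd \<Prod>S"
  have "\<Prod>S \<noteq> 0" using monic_prod_monic_irreducibles[OF assms(2)] by auto
  then have "g \<noteq> 0" using g by auto
  define c where "c = inverse (lead_coeff g)"
  have "c \<noteq> 0" using \<open>g \<noteq> 0\<close> by (simp add: c_def)
  have "smult c g dvd \<Prod>S"
    using g \<open>c \<noteq> 0\<close> by (metis dvd_trans dvd_triv_left power2_eq_square smult_dvd)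
  moreover have "lead_coeff (smult c g) = 1" using \<open>g \<noteq> 0\<close> by (simp add: c_def)
  ultimately obtain T where T: "T \<subseteq> S" "smult c g = \<Prod>T" using monic_divisors_prod[OF assms] by blast
  have "T = {}"
  proof (rule ccontr)
    assume "T \<noteq> {}"
    then obtain p where p: "p \<in> T" by blast
    have "finite T" using T assms finite_subset by blast
    then have "p dvd smult c g" using p T by (metis dvd_prodI)
    then have "p dvd g" using \<open>c \<noteq> 0\<close> by (simp add: dvd_smult_iff)
    then have "p * p dvd g ^ 2" by (simp add: power2_eq_square mult_dvd_mono)
    then have "p * p dvd \<Prod>S" using g dvd_trans by blast
    moreover have "\<Prod>S = p * \<Prod>(S - {p})" using p T assms by (subst prod.remove[of S p]) auto
    moreover have "p \<noteq> 0" using p T assms by (auto simp: monic_irreducibles_def)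
    ultimately have "p dvd \<Prod>(S - {p})" by simp
    then have "p \<in> S - {p}" using p T assms dvd_prod_monic_irreducibles[of "S - {p}" p] by blast
    then show False by blast
  qed
  then have "smult c g = 1" using T by simp
  then show "is_unit g" using \<open>c \<noteq> 0\<close> by (metis dvd_refl smult_dvd_iff)
qed

lemma degree_prod_monic_irreducibles:
  "S \<subseteq> monic_irreducibles \<Longrightarrow> degree (\<Prod>S) = sum degree S"
  by (subst degree_prod_sum_eq) (auto simp: monic_irreducibles_def)

lemma degree_1_irreducible: "[:c, 1:] \<in> monic_irreducibles" for c :: "'a::field"
proof -
  have "irreducible [:c, 1:]"
  proof (rule irreducibleI)
    fix a b assume ab: "[:c, 1:] = a * b"
    then have "a \<noteq> 0" "b \<noteq> 0" by auto
    then have "degree a + degree b = 1" using ab degree_mult_eq[of a b] by (simp flip: ab)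
    then show "is_unit a \<or> is_unit b" using \<open>a \<noteq> 0\<close> \<open>b \<noteq> 0\<close> by (auto simp: is_unit_iff_degree add_is_1)
  qed (auto simp: is_unit_poly_iff)
  then show ?thesis by (simp add: monic_irreducibles_def)
qed

lemma card_roots_prod_monic_irreducibles:
  fixes S :: "'a::field poly set"
  assumes "finite S" "S \<subseteq> monic_irreducibles"
  shows "card {t. poly (\<Prod>S) t = 0} = card {p \<in> S. degree p = 1}"
proof -
  have "poly (\<Prod>S) t = 0 \<longleftrightarrow> [:- t, 1:] \<in> S" for t
    unfolding poly_eq_0_iff_dvd
    using dvd_prod_monic_irreducibles[OF assms degree_1_irreducible] dvd_prodI[OF assms(1), of "[:- t, 1:]" "\<lambda>p. p"] by auto
  then have "{p \<in> S. degree p = 1} = (\<lambda>t. [:- t, 1:]) ` {t. poly (\<Prod>S) t = 0}"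
  proof (intro equalityI subsetI)
    fix p assume *: "\<And>t. poly (\<Prod>S) t = 0 \<longleftrightarrow> [:- t, 1:] \<in> S" and p: "p \<in> {p \<in> S. degree p = 1}"
    then have "lead_coeff p = 1" using assms by (auto simp: monic_irreducibles_def)
    moreover have "p = [:coeff p 0, coeff p 1:]" using p by (intro poly_eqI) (auto simp: coeff_pCons coeff_eq_0 split: nat.splits)
    ultimately have eq: "p = [:- (- coeff p 0), 1:]" using p by auto
    moreover have "poly (\<Prod>S) (- coeff p 0) = 0" using p unfolding * eq[symmetric] by blast
    ultimately show "p \<in> (\<lambda>t. [:- t, 1:]) ` {t. poly (\<Prod>S) t = 0}" by blast
  qed auto
  then show ?thesis by (simp add: card_image inj_on_def)
qed

text \<open>Reduces the line count to the degrees in \<open>S\<close>: rational roots are linear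
  members, with infinity added when the total degree is four, and cubic factors are subsets of
  \<open>S\<close>.\<close>

lemma ex_cubic_of_monic_irreducibles:
  fixes S :: "'a::{finite,field} poly set"
  assumes card: "CARD('a) \<ge> 4" and char2: "(2::'a) = 0"
    and S: "finite S" "S \<subseteq> monic_irreducibles" and deg: "sum degree S \<in> {4, 5}"
  shows "\<exists>F :: (4 \<Rightarrow> nat) \<Rightarrow> 'a. smooth_cubic F \<and> card (k_lines F) =
    2 + 3 * (card {p \<in> S. degree p = 1} + (if sum degree S = 4 then 1 else 0))
    + card {T. T \<subseteq> S \<and> sum degree T \<le> 3 \<and> sum degree S \<le> sum degree T + 2}"
proof -
  define a where "a = coeff (\<Prod>S)"
  have deg_h: "degree (\<Prod>S) = sum degree S" by (rule degree_prod_monic_irreducibles[OF S(2)])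
  have h: "\<Prod>S = [:a 0, a 1, a 2, a 3, a 4, a 5:]"
  proof (rule poly_eqI)
    fix n
    have "coeff (\<Prod>S) n = 0" if "n > 5" using that deg deg_h by (intro coeff_eq_0) auto
    then show "coeff (\<Prod>S) n = coeff [:a 0, a 1, a 2, a 3, a 4, a 5:] n"
      by (auto simp: a_def coeff_pCons numeral_eq_Suc split: nat.splits)
  qed
  have a_degree: "a (sum degree S) = 1"
    using monic_prod_monic_irreducibles[OF S(2)] by (simp add: a_def deg_h)
  interpret quintic_cubic "a 0" "a 1" "a 2" "a 3" "a 4" "a 5"
  proof
    show "squarefree [:a 0, a 1, a 2, a 3, a 4, a 5:]"
      unfolding h[symmetric] by (rule squarefree_prod_monic_irreducibles[OF S])
    show "a 4 \<noteq> 0 \<or> a 5 \<noteq> 0" using a_degree deg by auto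
  qed (fact card char2)+
  have h': "h = \<Prod>S" by (simp only: h_def h)
  have "card cubic_factors = card ((\<lambda>T. \<Prod>T) ` {T. T \<subseteq> S \<and> sum degree T \<le> 3 \<and> sum degree S \<le> sum degree T + 2})"
  proof (rule arg_cong[of _ _ card])
    have "cubic_factors = {g \<in> (\<lambda>T. \<Prod>T) ` Pow S. degree g \<le> 3 \<and> degree (\<Prod>S) \<le> degree g + 2}"
      unfolding monic_divisors_prod[OF S, symmetric] cubic_factors_def h' by blast
    also have "\<dots> = (\<lambda>T. \<Prod>T) ` {T. T \<subseteq> S \<and> sum degree T \<le> 3 \<and> sum degree S \<le> sum degree T + 2}"
    proof -
      have "degree (\<Prod>T) = sum degree T" if "T \<subseteq> S" for T
        using that S by (intro degree_prod_monic_irreducibles) auto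
      then show ?thesis unfolding deg_h by auto
    qed
    finally show "cubic_factors = (\<lambda>T. \<Prod>T) ` {T. T \<subseteq> S \<and> sum degree T \<le> 3 \<and> sum degree S \<le> sum degree T + 2}" .
  qed
  also have "\<dots> = card {T. T \<subseteq> S \<and> sum degree T \<le> 3 \<and> sum degree S \<le> sum degree T + 2}"
    by (intro card_image inj_on_subset[OF inj_on_prod_monic_irreducibles[OF S]]) auto
  finally have factors: "card cubic_factors = card {T. T \<subseteq> S \<and> sum degree T \<le> 3 \<and> sum degree S \<le> sum degree T + 2}" .
  have "a 5 = 0 \<longleftrightarrow> sum degree S = 4"
  proof
    assume "sum degree S = 4"
    then show "a 5 = 0" using deg_h by (simp add: a_def coeff_eq_0)
  next
    assume "a 5 = 0"
    then have "sum degree S \<noteq> 5" using a_degree by (metis zero_neq_one)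
    then show "sum degree S = 4" using deg by blast
  qed
  then have "card roots = card {p \<in> S. degree p = 1} + (if sum degree S = 4 then 1 else 0)"
    unfolding card_roots h' card_roots_prod_monic_irreducibles[OF S] by simp
  then show ?thesis using smooth card_k_lines_F factors by metis
qed

subsection \<open>Irreducible polynomials over finite fields\<close>

lemma monic_irreducibleI:
  fixes p :: "'a::field poly"
  assumes p: "lead_coeff p = 1" "degree p > 0"
    and no: "\<And>g. lead_coeff g = 1 \<Longrightarrow> 0 < degree g \<Longrightarrow> 2 * degree g \<le> degree p \<Longrightarrow> \<not> g dvd p"
  shows "p \<in> monic_irreducibles"
proof -
  have "irreducible p"
  proof (rule irreducibleI)
    show "p \<noteq> 0" using p by auto
    then show "\<not> is_unit p" using p(2) by (simp add: is_unit_iff_degree)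
    fix a b assume ab: "p = a * b"
    then have nz: "a \<noteq> 0" "b \<noteq> 0" using p(2) by auto
    have deg: "degree p = degree a + degree b" using nz unfolding ab by (rule degree_mult_eq)
    have *: "degree g = 0 \<or> 2 * degree g > degree p" if "g dvd p" "g \<noteq> 0" for g
    proof -
      let ?g = "smult (inverse (lead_coeff g)) g"
      have "?g dvd p" "lead_coeff ?g = 1" using that by (simp_all add: smult_dvd_iff)
      moreover have "degree ?g = degree g" using that(2) by simp
      ultimately show ?thesis using no[of ?g] by (metis gr0I not_le)
    qed
    have "degree a = 0 \<or> degree b = 0" using *[of a] *[of b] nz deg ab by auto
    then show "is_unit a \<or> is_unit b" using nz by (auto simp: is_unit_iff_degree)
  qed
  then show ?thesis using p(1) by (simp add: monic_irreducibles_def)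
qed

lemma monic_degree_1E:
  fixes g :: "'a::field poly"
  assumes "lead_coeff g = 1" "degree g = 1"
  obtains b :: "'a::field" where "g = [:b, 1:]"
proof -
  have "g = [:coeff g 0, 1:]"
    using assms by (intro poly_eqI) (auto simp: coeff_pCons coeff_eq_0 split: nat.splits)
  then show ?thesis using that by blast
qed

lemma monic_degree_2E:
  fixes g :: "'a::field poly"
  assumes "lead_coeff g = 1" "degree g = 2"
  obtains b a :: "'a::field" where "g = [:b, a, 1:]"
proof -
  have "g = [:coeff g 0, coeff g 1, 1:]"
    using assms by (intro poly_eqI) (auto simp: coeff_pCons coeff_eq_0 numeral_2_eq_2 split: nat.splits)
  then show ?thesis using that by blast
qed

lemma monic_irreducible_of_no_root:
  fixes p :: "'a::field poly"
  assumes p: "lead_coeff p = 1" "degree p \<in> {2, 3}" and no: "\<And>x. poly p x \<noteq> 0"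
  shows "p \<in> monic_irreducibles"
proof (rule monic_irreducibleI[OF p(1)])
  show "degree p > 0" using p by auto
  fix g :: "'a poly" assume g: "lead_coeff g = 1" "0 < degree g" "2 * degree g \<le> degree p"
  then have "degree g = 1" using p by auto
  with g(1) obtain b where "g = [:b, 1:]" by (rule monic_degree_1E)
  then have "\<not> [:- (- b), 1:] dvd p \<Longrightarrow> \<not> g dvd p" by simp
  then show "\<not> g dvd p" using no[of "- b"] by (simp only: poly_eq_0_iff_dvd) blast
qed

text \<open>This is $s^2 + c s + c^3$ with $s = t^2 + t$.\<close>
lemma quartic_irreducible:
  fixes c :: "'a::field"
  assumes char2: "(2::'a) = 0" and c: "\<And>t. t ^ 2 + t \<noteq> c"
  shows "[:c ^ 3, c, 1 + c, 0, 1:] \<in> monic_irreducibles" (is "?p \<in> _")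
proof (rule monic_irreducibleI)
  note neg = char2_neg[OF char2] and add_self = char2_add_self[OF char2]
    and eq0 = char2_add_eq_0_iff[OF char2]
  have c0: "c \<noteq> 0" using c[of 0] by auto
  have c': "s ^ 2 + c * s + c ^ 3 \<noteq> 0" for s
  proof
    assume "s ^ 2 + c * s + c ^ 3 = 0"
    moreover have "s ^ 2 + c * s + c ^ 3 = c ^ 2 * ((s / c) ^ 2 + s / c + c)"
      using c0 by (simp add: field_simps power2_eq_square power3_eq_cube)
    ultimately have "(s / c) ^ 2 + s / c + c = 0" using c0 by simp
    then show False using c[of "s / c"] by (simp add: eq0)
  qed
  fix g :: "'a poly" assume g: "lead_coeff g = 1" "0 < degree g" "2 * degree g \<le> degree ?p"
  then have "degree g = 1 \<or> degree g = 2" by auto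
  then show "\<not> g dvd ?p"
  proof
    assume "degree g = 1"
    with g(1) obtain b where b: "g = [:b, 1:]" by (rule monic_degree_1E)
    have "poly ?p (- b) = (b ^ 2 + b) ^ 2 + c * (b ^ 2 + b) + c ^ 3 - 2 * (b ^ 3 + c * b)"
      by (simp add: algebra_simps power_numeral_reduce)
    also have "\<dots> = (b ^ 2 + b) ^ 2 + c * (b ^ 2 + b) + c ^ 3"
      by (simp only: char2 mult_zero_left diff_zero)
    finally have "poly ?p (- b) \<noteq> 0" using c'[of "b ^ 2 + b"] by (simp only: not_False_eq_True)
    then show ?thesis by (simp only: b poly_eq_0_iff_dvd minus_minus not_False_eq_True)
  next
    assume "degree g = 2"
    with g(1) obtain b a where b: "g = [:b, a, 1:]" by (rule monic_degree_2E)
    show ?thesis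
    proof
      assume "g dvd ?p"
      then obtain k where k: "?p = g * k" by blast
      then have "k \<noteq> 0" by auto
      then have "degree ?p = degree g + degree k" unfolding k using b by (intro degree_mult_eq) auto
      then have "degree k = 2" using b by simp
      moreover have "lead_coeff ?p = 1" by simp
      then have "lead_coeff k = 1" unfolding k lead_coeff_mult g(1) by simp
      ultimately have "degree k = 2" "lead_coeff k = 1" by blast+
      then obtain b' a' where b': "k = [:b', a', 1:]" by (metis monic_degree_2E)
      have eqs: "c ^ 3 = b * b'" "c = b * a' + a * b'" "1 + c = b + a * a' + b'" "0 = a + a'"
      proof -
        have "g * k = [:b * b', b * a' + a * b', b + a * a' + b', a + a', 1:]"
          unfolding b b' by (simp add: algebra_simps)
        with k have "?p = [:b * b', b * a' + a * b', b + a * a' + b', a + a', 1:]" by (rule trans)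
        then show "c ^ 3 = b * b'" "c = b * a' + a * b'" "1 + c = b + a * a' + b'" "0 = a + a'"
          unfolding pCons_eq_iff by blast+
      qed
      then have a': "a' = a" by (metis eq0)
      have bb: "b + b' = 1 + c + a ^ 2"
      proof -
        have "b + b' + a ^ 2 + a ^ 2 = 1 + c + a ^ 2" using eqs(3) by (simp add: a' power2_eq_square algebra_simps)
        then show ?thesis by (simp add: add.assoc add_self)
      qed
      have "c = a * (b + b')" using eqs(2) by (simp add: a' algebra_simps)
      then have "a * (1 + c + a ^ 2) + c = 0" unfolding bb by (simp only: eq0)
      \<comment> \<open>Since \<open>a^2 + a + c\<close> has no root, a = 1. The factors are then
        \<open>t^2 + t + b\<close> and \<open>t^2 + t + b + c\<close>, so \<open>s = b\<close> would
        be a root of \<open>s^2 + c s + c^3\<close>.\<close>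
      then have "(a + 1) * (a ^ 2 + a + c) - 2 * a ^ 2 = 0"
        by (simp add: algebra_simps power2_eq_square)
      then have "a = 1" using c[of a] char2 by (simp add: eq0)
      then have b'_eq: "b' = b + c"
      proof -
        have "b + b' = c" using bb \<open>a = 1\<close> by (simp add: algebra_simps add_self flip: add.assoc)
        then have "b + (b + b') = b + c" by simp
        then show ?thesis by (simp add: add_self flip: add.assoc)
      qed
      have "b ^ 2 + c * b + c ^ 3 = 2 * (b ^ 2 + c * b)"
        using eqs(1) unfolding b'_eq by (simp add: power2_eq_square algebra_simps)
      then have "b ^ 2 + c * b + c ^ 3 = 0" by (simp only: char2 mult_zero_left)
      then show False using c' by blast
    qed
  qed
qed simp_all

section \<open>Frobenius and an irreducible quintic\<close>

lemma power_CARD_eq_self: "x ^ CARD('a) = x" for x :: "'a::{finite,field}"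
proof (cases "x = 0")
  case False
  define U :: "'a set" where "U = UNIV - {0}"
  have "bij_betw (\<lambda>y. x * y) U U"
    by (rule bij_betwI[of _ _ _ "\<lambda>y. y / x"]) (use False in \<open>auto simp: U_def\<close>)
  then have "\<Prod>U = (\<Prod>y\<in>U. x * y)" by (rule prod.reindex_bij_betw[of _ _ _ "\<lambda>y. y", symmetric])
  also have "\<dots> = x ^ card U * \<Prod>U" by (simp add: prod.distrib)
  finally have "x ^ card U = 1" by (auto simp: U_def)
  moreover have "CARD('a) = Suc (card U)" unfolding U_def by (simp add: card_Suc_Diff1)
  ultimately show ?thesis by simp
qed simp

text \<open>Every element of k satisfies the equation, and \<open>X^q - X\<close> has no room for
  more than q roots.\<close>

lemma range_to_ac_eq: "range (to_ac :: 'a::{finite,field} \<Rightarrow> _) = {x. x ^ CARD('a) = x}"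
proof (rule card_seteq)
  define P :: "'a alg_closure poly" where "P = monom 1 (CARD('a)) - [:0, 1:]"
  have q: "CARD('a) > 1"
    using card_mono[of UNIV "{0, 1 :: 'a}"] by simp
  have "coeff P (CARD('a)) = 1" using q by (simp add: P_def coeff_pCons split: nat.split)
  then have "P \<noteq> 0" by auto
  have P: "{x. x ^ CARD('a) = x} = {x. poly P x = 0}"
    by (auto simp: P_def poly_monom)
  show "finite {x :: 'a alg_closure. x ^ CARD('a) = x}"
    unfolding P by (rule poly_roots_finite[OF \<open>P \<noteq> 0\<close>])
  have "degree P \<le> CARD('a)" unfolding P_def using q
    by (intro degree_diff_le) (auto simp: degree_monom_le)
  then show "card {x :: 'a alg_closure. x ^ CARD('a) = x} \<le> card (range (to_ac :: 'a \<Rightarrow> _))"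
    unfolding P using card_poly_roots_bound[OF \<open>P \<noteq> 0\<close>] by (simp add: card_image inj_to_ac)
  show "range (to_ac :: 'a \<Rightarrow> _) \<subseteq> {x. x ^ CARD('a) = x}"
    by (auto simp flip: to_ac_power simp: power_CARD_eq_self)
qed

lemma char2_add_power:
  fixes x y :: "'a::comm_ring_1"
  assumes "(2::'a) = 0"
  shows "(x + y) ^ 2 ^ d = x ^ 2 ^ d + y ^ 2 ^ d"
proof (induction d)
  case (Suc d)
  have Suc_power: "z ^ 2 ^ Suc d = (z ^ 2 ^ d) ^ 2" for z :: 'a
    by (simp only: power_Suc2 power_mult)
  have "(x + y) ^ 2 ^ Suc d = (x ^ 2 ^ d) ^ 2 + (y ^ 2 ^ d) ^ 2 + 2 * x ^ 2 ^ d * y ^ 2 ^ d"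
    unfolding Suc_power Suc by (rule power2_sum)
  then show ?case by (simp only: Suc_power assms mult_zero_left add_0_right)
qed simp

text \<open>The polynomial $X^N - X$ is separable because its derivative is $-1$.\<close>
lemma card_fixed_points_power:
  fixes N :: nat
  assumes "(of_nat N :: 'a::alg_closed_field) = 0" "N > 1"
  shows "card {x :: 'a. x ^ N = x} = N"
proof -
  define P :: "'a poly" where "P = monom 1 N - [:0, 1:]"
  have "coeff P N = 1" using assms(2) by (simp add: P_def coeff_pCons split: nat.split)
  moreover have "degree P \<le> N" unfolding P_def using assms(2)
    by (intro degree_diff_le) (auto simp: degree_monom_le)
  ultimately have "degree P = N" by (intro antisym le_degree) simp_all
  with \<open>coeff P N = 1\<close> have P: "P \<noteq> 0" "degree P = N" "lead_coeff P = 1" by auto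
  obtain A where A: "size A = degree P" "P = (\<Prod>x\<in>#A. [:-x, 1:])"
    using alg_closed_imp_factorization[OF P(1)] P(3) by auto
  have pd: "pderiv P = - 1"
    using assms by (simp add: P_def pderiv_diff pderiv_monom pderiv_pCons one_pCons)
  have "count A x \<le> 1" for x
  proof (rule ccontr)
    assume "\<not> count A x \<le> 1"
    then have "{#x, x#} \<subseteq># A" by (auto simp: subseteq_mset_def)
    then obtain B where "A = {#x, x#} + B" by (metis subset_mset.add_diff_inverse)
    then have "P = [:-x, 1:] * ([:-x, 1:] * (\<Prod>x\<in>#B. [:-x, 1:]))" using A(2) by (simp add: mult_ac)
    then obtain C where "P = [:-x, 1:] * ([:-x, 1:] * C)" by blast
    then have "poly (pderiv P) x = 0" by (simp only: pderiv_mult) simp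
    then show False unfolding pd by simp
  qed
  then have "size A \<le> card (set_mset A)"
    unfolding size_multiset_overloaded_eq using sum_mono[of "set_mset A" "count A" "\<lambda>_. 1"] by simp
  moreover have "set_mset A = {x. poly P x = 0}" unfolding A(2) by (auto simp: poly_prod_mset)
  moreover have "{x. poly P x = 0} = {x. x ^ N = x}" by (auto simp: P_def poly_monom)
  ultimately have "N \<le> card {x :: 'a. x ^ N = x}" using A(1) P(2) by simp
  moreover have "card {x :: 'a. x ^ N = x} \<le> N"
    using card_poly_roots_bound[OF P(1)] P(2) \<open>{x. poly P x = 0} = {x. x ^ N = x}\<close> by simp
  ultimately show ?thesis by simp
qed

lemma map_poly_mult_hom:
  fixes f :: "'a::comm_ring_1 \<Rightarrow> 'b::comm_ring_1"
  assumes "f 0 = 0" "\<And>x y. f (x + y) = f x + f y" "\<And>x y. f (x * y) = f x * f y"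
  shows "map_poly f (p * q) = map_poly f p * map_poly f q"
proof -
  have "f (sum g A) = (\<Sum>x\<in>A. f (g x))" for g :: "nat \<Rightarrow> 'a" and A
    by (induction A rule: infinite_finite_induct) (simp_all add: assms)
  then show ?thesis by (intro poly_eqI) (simp add: coeff_map_poly coeff_mult assms)
qed

text \<open>The five conjugates of an element of $\mathbb{F}_{q^5} - \mathbb{F}_q$ are the roots of such a polynomial.\<close>
lemma ex_quintic_irreducible:
  assumes CARD: "CARD('a::{finite,field}) = 2 ^ d" and d: "d > 0"
  shows "\<exists>p :: 'a poly. p \<in> monic_irreducibles \<and> degree p = 5"
proof -
  define q where "q = CARD('a)"
  have "(2::'a) = 0" by (rule char2_of_CARD[OF CARD])
  then have two: "(2 :: 'a alg_closure) = 0" by (rule char2_alg_closure)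
  have q: "q > 1" unfolding q_def CARD by (rule one_less_power[OF _ d]) simp
  define \<phi> :: "'a alg_closure \<Rightarrow> 'a alg_closure" where "\<phi> x = x ^ q" for x
  have \<phi>_add: "\<phi> (x + y) = \<phi> x + \<phi> y" for x y
    unfolding \<phi>_def q_def CARD by (rule char2_add_power[OF two])
  have \<phi>_mult: "\<phi> (x * y) = \<phi> x * \<phi> y" for x y by (simp add: \<phi>_def power_mult_distrib)
  have \<phi>_0: "\<phi> 0 = 0" and \<phi>_1: "\<phi> 1 = 1" using q by (simp_all add: \<phi>_def)
  have \<phi>_minus: "\<phi> (- x) = - \<phi> x" for x by (simp add: char2_neg[OF two])
  have range: "x \<in> range to_ac \<longleftrightarrow> \<phi> x = x" for x
    unfolding range_to_ac_eq \<phi>_def q_def by blast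
  have iter: "(\<phi> ^^ n) x = x ^ (q ^ n)" for n x
    by (induction n) (simp_all add: \<phi>_def power_mult mult.commute flip: power_mult)
  have "card {x :: 'a alg_closure. x ^ q ^ 5 = x} = q ^ 5"
  proof (rule card_fixed_points_power)
    have "of_nat q = (2 :: 'a alg_closure) ^ d" by (simp add: q_def CARD)
    also have "\<dots> = 0" using d by (simp add: two)
    finally show "of_nat (q ^ 5) = (0 :: 'a alg_closure)" by simp
    show "q ^ 5 > 1" using q by (rule one_less_power) simp
  qed
  moreover have "card {x :: 'a alg_closure. \<phi> x = x} = q"
    using range_to_ac_eq[where 'a = 'a] unfolding \<phi>_def q_def
    by (simp flip: range_to_ac_eq add: card_image inj_to_ac)
  moreover have "q < q ^ 5" using power_strict_increasing[of 1 5 q] q by simp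
  \<comment> \<open>The fifth power of Frobenius fixes \<open>q^5\<close> elements but Frobenius
    only \<open>q\<close>; any element of the difference will do.\<close>
  ultimately have "\<not> {x :: 'a alg_closure. x ^ q ^ 5 = x} \<subseteq> {x. \<phi> x = x}"
    by (metis (no_types, lifting) card_mono card.infinite not_le q zero_less_one order_less_trans less_numeral_extra(3))
  then obtain x where x5: "(\<phi> ^^ 5) x = x" and x1: "\<phi> x \<noteq> x" by (auto simp: iter)
  have \<phi>5: "\<phi> (\<phi> (\<phi> (\<phi> (\<phi> x)))) = x" using x5 by (simp add: numeral_eq_Suc)
  define R where "R = {x, \<phi> x, \<phi> (\<phi> x), \<phi> (\<phi> (\<phi> x)), \<phi> (\<phi> (\<phi> (\<phi> x)))}"
  have inj: "\<phi> y = \<phi> z \<longleftrightarrow> y = z" for y z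
  proof
    assume "\<phi> y = \<phi> z"
    then have "\<phi> (y + z) = 0" unfolding \<phi>_add by (simp add: char2_add_self[OF two])
    then have "y + z = 0" by (simp add: \<phi>_def)
    then show "y = z" by (simp add: char2_add_eq_0_iff[OF two])
  qed simp
  have 1: "\<phi> x \<noteq> x" by fact
  \<comment> \<open>The orbit length divides the prime 5 and is not 1; the shorter periods are
    excluded one at a time.\<close>
  have 2: "\<phi> (\<phi> x) \<noteq> x" using \<phi>5 x1 by metis
  have 3: "\<phi> (\<phi> (\<phi> x)) \<noteq> x" using \<phi>5 2 by metis
  have 4: "\<phi> (\<phi> (\<phi> (\<phi> x))) \<noteq> x" using \<phi>5 x1 by metis
  have card_R: "card R = 5"
    using 1 2 3 4 1[symmetric] 2[symmetric] 3[symmetric] 4[symmetric]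
    by (simp add: R_def card_insert_if inj)
  have \<phi>R: "\<phi> ` R = R" using \<phi>5 by (auto simp: R_def)
  have bij: "bij_betw \<phi> R R" unfolding bij_betw_def using \<phi>R by (simp add: inj_on_def inj)
  define P where "P = (\<Prod>r\<in>R. [:- r, 1:])"
  have "finite R" by (simp add: R_def)
  have mult: "map_poly \<phi> (f * g) = map_poly \<phi> f * map_poly \<phi> g" for f g
    by (rule map_poly_mult_hom) (fact \<phi>_0 \<phi>_add \<phi>_mult)+
  \<comment> \<open>Frobenius permutes the linear factors, so it fixes the coefficients of the
    product, which therefore lie in k.\<close>
  have "map_poly \<phi> P = (\<Prod>r\<in>R. map_poly \<phi> [:- r, 1:])"
    unfolding P_def using \<open>finite R\<close>
    by (induction R rule: finite_induct) (simp_all only: mult prod.insert prod.empty map_poly_1' \<phi>_1 not_False_eq_True)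
  also have "\<dots> = (\<Prod>r\<in>R. [:- \<phi> r, 1:])"
    by (simp add: map_poly_pCons \<phi>_0 \<phi>_1 \<phi>_minus)
  also have "\<dots> = P" unfolding P_def
    by (rule prod.reindex_bij_betw[OF bij, of "\<lambda>r. [:- r, 1:]"])
  finally have "\<phi> (coeff P n) = coeff P n" for n by (metis coeff_map_poly \<phi>_0)
  then have "coeff P n \<in> range to_ac" for n by (simp add: range)
  define p where "p = map_poly of_ac P"
  have p: "map_poly to_ac p = P"
    by (intro poly_eqI) (simp add: p_def coeff_map_poly to_ac_of_ac \<open>\<And>n. coeff P n \<in> range to_ac\<close>)
  have "degree P = 5" "lead_coeff P = 1"
    unfolding P_def lead_coeff_prod using card_R \<open>finite R\<close> by (simp_all add: degree_prod_sum_eq)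
  have deg: "degree (map_poly to_ac g) = degree g" for g :: "'a poly"
    by (rule degree_map_poly) simp
  have deg_p: "degree p = 5" using deg[of p] \<open>degree P = 5\<close> by (simp add: p)
  have "to_ac (lead_coeff p) = lead_coeff P" unfolding p[symmetric] deg by (simp add: coeff_map_poly)
  then have lead_p: "lead_coeff p = 1" using \<open>lead_coeff P = 1\<close> by (metis to_ac_1 to_ac_eq_iff)
  have "p \<in> monic_irreducibles"
  proof (rule monic_irreducibleI[OF lead_p])
    show "degree p > 0" by (simp add: deg_p)
    fix g :: "'a poly" assume g: "lead_coeff g = 1" "0 < degree g" "2 * degree g \<le> degree p"
    define G where "G = map_poly to_ac g"
    show "\<not> g dvd p"
    proof
      assume "g dvd p"
      then have "G dvd P" unfolding G_def p[symmetric] by (metis dvd_def map_poly_to_ac_mult)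
      have "degree G > 0" using g by (simp add: G_def deg)
      then obtain y where y: "poly G y = 0" using alg_closed_imp_poly_has_root by blast
      then have "poly P y = 0" using \<open>G dvd P\<close> by (metis dvd_trans poly_eq_0_iff_dvd)
      then have "y \<in> R" unfolding P_def using \<open>finite R\<close> by (auto simp: poly_prod)
      have step: "poly G (\<phi> z) = 0" if "poly G z = 0" for z
      proof -
        have "\<phi> (poly (map_poly to_ac f) z) = poly (map_poly to_ac f) (\<phi> z)" for f :: "'a poly"
        proof (induction f)
          case (pCons a f)
          have "\<phi> (to_ac a) = to_ac a" using range by blast
          then show ?case using pCons by (simp add: map_poly_pCons \<phi>_add \<phi>_mult)
        qed (simp add: \<phi>_0)
        then show ?thesis using that \<phi>_0 unfolding G_def by metis
      qed
      \<comment> \<open>The roots of a polynomial over k are closed under Frobenius, so one root in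
        the orbit brings all five, too many for degree at most two.\<close>
      have "poly G z = 0" if "z \<in> R" for z
        using \<open>y \<in> R\<close> that y step[of y] step[of "\<phi> y"] step[of "\<phi> (\<phi> y)"] step[of "\<phi> (\<phi> (\<phi> y))"] \<phi>5
        unfolding R_def by auto
      then have "R \<subseteq> {z. poly G z = 0}" by blast
      moreover have "G \<noteq> 0" using \<open>degree G > 0\<close> by auto
      ultimately have "card R \<le> card {z. poly G z = 0}" by (intro card_mono poly_roots_finite)
      then have "5 \<le> degree G" using card_poly_roots_bound[OF \<open>G \<noteq> 0\<close>] card_R by linarith
      then show False using g deg_p by (simp add: G_def deg)
    qed
  qed
  then show ?thesis using deg_p by blast
qed

section \<open>Realization of the nine counts\<close>

text \<open>Lets the simplifier enumerate the subsets of an explicit set of factors, with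
  cardinalities written as sums of indicators.\<close>

lemma sum_Pow_insert:
  assumes "finite S" "a \<notin> S"
  shows "sum g (Pow (insert a S)) = sum g (Pow S) + (\<Sum>T\<in>Pow S. g (insert a T))"
proof -
  have "inj_on (insert a) (Pow S)"
    using assms(2) by (intro inj_onI) (metis PowD insert_ident subsetD)
  moreover have "Pow S \<inter> insert a ` Pow S = {}" using assms(2) by auto
  ultimately show ?thesis
    unfolding Pow_insert using assms(1) by (simp add: sum.union_disjoint sum.reindex)
qed

theorem theorem1p4:
  fixes d n :: nat
  assumes "d > 1"
    and "CARD('a::{finite,field}) = 2 ^ d"
    and "n \<in> {0, 1, 2, 3, 5, 7, 9, 15, 27}"
  shows "\<exists>F :: (4 \<Rightarrow> nat) \<Rightarrow> 'a. smooth_cubic F \<and> card (k_lines F) = n"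
proof -
  have card: "CARD('a) \<ge> 4"
    using power_increasing[of 2 d "2 :: nat"] assms(1,2) by simp
  have char2: "(2::'a) = 0" by (rule char2_of_CARD[OF assms(2)])
  note neg = char2_neg[OF char2] and eq0 = char2_add_eq_0_iff[OF char2]
  obtain c :: 'a where c: "\<And>t. t ^ 2 + t \<noteq> c"
    using noninjective_misses_value[of "\<lambda>t :: 'a. t ^ 2 + t" 0 1] char2 by auto
  obtain b :: 'a where b: "\<And>t. t ^ 3 + t \<noteq> b"
    using noninjective_misses_value[of "\<lambda>t :: 'a. t ^ 3 + t" 0 1] char2 by auto
  have "c \<noteq> 0" "b \<noteq> 0" using c[of 0] b[of 0] by auto
  \<comment> \<open>The coincidence of values at 0 and c from which the constant \<open>f\<close> is
    obtained.\<close>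
  have "c ^ 3 + c * c ^ 2 = 0" by (simp add: char2 power2_eq_square power3_eq_cube)
  then obtain f :: 'a where f: "\<And>t. t ^ 3 + c * t ^ 2 \<noteq> f"
    using noninjective_misses_value[of "\<lambda>t :: 'a. t ^ 3 + c * t ^ 2" 0 c] \<open>c \<noteq> 0\<close> by auto
  have "f \<noteq> 0" using f[of 0] by auto
  obtain e :: 'a where e: "e \<noteq> 0" "e \<noteq> 1" by (rule ex_not_0_1[OF card])
  note ex_cubic_card = ex_cubic_of_monic_irreducibles[OF card char2]
  have ex_cubic: "\<exists>F :: (4 \<Rightarrow> nat) \<Rightarrow> 'a. smooth_cubic F \<and> card (k_lines F) =
      2 + 3 * ((\<Sum>p\<in>S. of_bool (degree p = 1)) + (if sum degree S = 4 then 1 else 0))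
      + (\<Sum>T\<in>Pow S. of_bool (sum degree T \<le> 3 \<and> sum degree S \<le> sum degree T + 2))"
    if "finite S" "S \<subseteq> monic_irreducibles" "sum degree S \<in> {4, 5}" for S :: "'a poly set"
  proof -
    have "(\<Sum>p\<in>S. of_bool (degree p = 1)) = card {p \<in> S. degree p = 1}"
      "(\<Sum>T\<in>Pow S. of_bool (sum degree T \<le> 3 \<and> sum degree S \<le> sum degree T + 2))
        = card {T. T \<subseteq> S \<and> sum degree T \<le> 3 \<and> sum degree S \<le> sum degree T + 2}"
      using that(1) by (simp_all add: sum_of_bool_eq Int_def)
    then show ?thesis using ex_cubic_card[OF that] by simp
  qed
  have quadratic: "[:c, 1, 1:] \<in> monic_irreducibles"
  proof (rule monic_irreducible_of_no_root)
    show "poly [:c, 1, 1:] t \<noteq> 0" for t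
      using c[of t] eq0[of c "t ^ 2 + t"] by (auto simp: algebra_simps power2_eq_square)
  qed simp_all
  \<comment> \<open>The first quadratic rescaled by \<open>t / e\<close>; it is a different
    polynomial because e is not 1.\<close>
  have quadratic': "[:e ^ 2 * c, e, 1:] \<in> monic_irreducibles"
  proof (rule monic_irreducible_of_no_root)
    fix t
    have "poly [:e ^ 2 * c, e, 1:] t = e ^ 2 * (c + ((t / e) ^ 2 + t / e))"
      using e by (simp add: field_simps power2_eq_square)
    then show "poly [:e ^ 2 * c, e, 1:] t \<noteq> 0" using c[of "t / e"] e by (simp add: eq0)
  qed simp_all
  have cubic: "[:b, 1, 0, 1:] \<in> monic_irreducibles"
  proof (rule monic_irreducible_of_no_root)
    show "poly [:b, 1, 0, 1:] t \<noteq> 0" for t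
      using b[of t] eq0[of b "t ^ 3 + t"] by (auto simp: algebra_simps power3_eq_cube)
  qed simp_all
  note quartic = quartic_irreducible[OF char2 c]
  note linear = degree_1_irreducible
  consider "n = 0" | "n = 1" | "n = 2" | "n = 3" | "n = 5" | "n = 7" | "n = 9" | "n = 15" | "n = 27"
    using assms(3) by blast
  then show ?thesis
  proof cases
    case 1
    have "k_lines (cubic_0 b) = {}" using b by (intro k_lines_cubic_0[OF card]) (simp add: neg)
    then show ?thesis using smooth_cubic_0[OF char2 \<open>b \<noteq> 0\<close>] 1 by (metis card.empty)
  next
    case 2
    have "k_lines (cubic_1 c f) = {span2 (vec4 1 0 0 0) (vec4 0 1 0 0)}"
      using c f by (intro k_lines_cubic_1[OF card char2]) (simp_all add: neg)
    then have "card (k_lines (cubic_1 c f)) = 1" by simp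
    then show ?thesis using smooth_cubic_1[OF char2 \<open>f \<noteq> 0\<close>] 2 by blast
  next
    case 3
    obtain p :: "'a poly" where p: "p \<in> monic_irreducibles" "degree p = 5"
      using ex_quintic_irreducible[OF assms(2)] assms(1) by auto
    then show ?thesis using ex_cubic[of "{p}"] 3 by (simp add: sum_Pow_insert del: sum_of_bool_eq)
  next
    case 4
    have "card (k_lines (cubic_3 c)) = 3"
      using c by (intro card_k_lines_cubic_3[OF card char2]) (simp add: neg)
    then show ?thesis using smooth_cubic_3[OF char2] 4 by blast
  next
    case 5
    \<comment> \<open>The degree is four here and in the cases below, so infinity is the remaining
      rational root.\<close>
    then show ?thesis using ex_cubic[of "{[:c ^ 3, c, 1 + c, 0, 1:]}"] quartic by (simp add: sum_Pow_insert del: sum_of_bool_eq)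
  next
    case 6
    show ?thesis using e ex_cubic[of "{[:c, 1, 1:], [:e ^ 2 * c, e, 1:]}"] quadratic quadratic' 6
      by (simp add: sum_Pow_insert del: sum_of_bool_eq)
  next
    case 7
    then show ?thesis using ex_cubic[of "{[:0, 1:], [:b, 1, 0, 1:]}"] linear[of "0 :: 'a"] cubic by (simp add: sum_Pow_insert del: sum_of_bool_eq)
  next
    case 8
    then show ?thesis
      using ex_cubic[of "{[:0, 1:], [:1, 1:], [:c, 1, 1:]}"] linear[of "0 :: 'a"] linear[of "1 :: 'a"] quadratic
      by (simp add: sum_Pow_insert del: sum_of_bool_eq)
  next
    case 9
    \<comment> \<open>Four field elements and infinity are the five rational roots; the factors to
      be counted are the pairs and triples of the four linear polynomials, 6 + 4 = 10.\<close>
    obtain C :: "'a set" where C: "card C = 4" "finite C"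
      using obtain_subset_with_card_n[OF card] by (metis finite)
    define S where "S = (\<lambda>c. [:c, 1:]) ` C"
    have S: "finite S" "card S = 4" "S \<subseteq> monic_irreducibles"
      using C linear by (auto simp: S_def card_image inj_on_def)
    have deg: "sum degree T = card T" if "T \<subseteq> S" for T
    proof -
      have "sum degree T = (\<Sum>p\<in>T. 1)" using that by (intro sum.cong) (auto simp: S_def)
      then show ?thesis by simp
    qed
    have "{p \<in> S. degree p = 1} = S" by (auto simp: S_def)
    moreover have "{T. T \<subseteq> S \<and> sum degree T \<le> 3 \<and> 4 \<le> sum degree T + 2}
        = {T. T \<subseteq> S \<and> card T = 2} \<union> {T. T \<subseteq> S \<and> card T = 3}"
      using deg by auto
    moreover have "card ({T. T \<subseteq> S \<and> card T = 2} \<union> {T. T \<subseteq> S \<and> card T = 3}) = (4 choose 2) + (4 choose 3)"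
      using S by (subst card_Un_disjoint) (auto simp: n_subsets)
    ultimately show ?thesis
      using ex_cubic_card[OF S(1,3)] deg[of S] S(2) 9 by (simp add: choose_two eval_nat_numeral)
  qed
qed

end
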